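(* Let $K$ be a field and $X$ a finite connected poset. The group $\mathrm{LAut}(I(X,K))$ of Lie automorphisms of the incidence algebra $I(X,K)$ is isomorphic to the semidirect product $\mathrm{Inn}_1(I(X,K))\rtimes\widetilde{\mathrm{LAut}}(I(X,K))$, where $\mathrm{Inn}_1(I(X,K))$ is the group of conjugations $f\mapsto \beta f\beta^{-1}$ by elements $\beta\in I(X,K)$ with $\beta(x,x)=1$ for all $x\in X$, and $\widetilde{\mathrm{LAut}}(I(X,K))$ is the image of the map $\varphi\mapsto\widetilde\varphi$ defined below.
   Context: A poset $X$ is connected if for any $x,y\in X$ there is a sequence $x=x_0,x_1,\dots,x_m=y$ in which, for each $i$, one of $x_i,x_{i+1}$ covers the other. The incidence algebra $I(X,K)$ is the $K$-vector space of functions $f:X\times X\to K$ with $f(x,y)=0$ unless $x\le y$, with product $(fg)(x,y)=\sum_{x\le t\le y}f(x,t)g(t,y)$. For $x\le y$, $e_{xy}$ denotes the function equal to $1$ at $(x,y)$ and $0$ elsewhere; $\{e_{xy}:x\le y\}$ is a basis. $I(X,K)$ is a Lie algebra under $[f,g]=fg-gf$, and a Lie automorphism is a bijective $K$-linear map preserving this bracket. For $x\le y$ let $\lfloor x,y\rfloor=\{z: x\le z\le y\}$ and let $l(\lfloor x,y\rfloor)$ be the maximum length of a chain in $\lfloor x,y\rfloor$ (the length of a chain is its cardinality minus one). For $i\ge0$ let $L_i=\mathrm{span}_K\{e_{xy}: l(\lfloor x,y\rfloor)=i\}$, so $I(X,K)=\bigoplus_{i\ge0}L_i$. For a Lie automorphism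 $\varphi$, $\widetilde\varphi$ is the $K$-linear map such that, for $e_{xy}\in L_i$, $\widetilde\varphi(e_{xy})$ is the component in $L_i$ of $\varphi(e_{xy})$ with respect to this direct sum decomposition (one has $\varphi(e_{xy})-\widetilde\varphi(e_{xy})\in\bigoplus_{k>i}L_k$). *)

theory Defs
  imports Main "HOL-Algebra.Algebra" "HOL-Library.Function_Algebras"
begin

definition covers :: "'a::order \<Rightarrow> 'a \<Rightarrow> bool" where
  "covers y x \<longleftrightarrow> x < y \<and> \<not> (\<exists>z. x < z \<and> z < y)"

definition poset_connected :: "'a::order itself \<Rightarrow> bool" where
  "poset_connected _ \<longleftrightarrow>
     (\<forall>x y::'a. (\<lambda>a b. covers a b \<or> covers b a)\<^sup>*\<^sup>* x y)"

definition Inc :: "('a::order \<Rightarrow> 'a \<Rightarrow> 'k::field) set" where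
  "Inc = {f. \<forall>x y. \<not> x \<le> y \<longrightarrow> f x y = 0}"

definition inc_mult :: "('a::order \<Rightarrow> 'a \<Rightarrow> 'k::field) \<Rightarrow> ('a \<Rightarrow> 'a \<Rightarrow> 'k) \<Rightarrow> ('a \<Rightarrow> 'a \<Rightarrow> 'k)" where
  "inc_mult f g = (\<lambda>x y. \<Sum>t\<in>{t. x \<le> t \<and> t \<le> y}. f x t * g t y)"

definition inc_one :: "'a \<Rightarrow> 'a \<Rightarrow> 'k::field" where
  "inc_one = (\<lambda>x y. if x = y then 1 else 0)"

definition inc_smult :: "'k::field \<Rightarrow> ('a \<Rightarrow> 'a \<Rightarrow> 'k) \<Rightarrow> ('a \<Rightarrow> 'a \<Rightarrow> 'k)" where
  "inc_smult c f = (\<lambda>x y. c * f x y)"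

definition lie_bracket :: "('a::order \<Rightarrow> 'a \<Rightarrow> 'k::field) \<Rightarrow> ('a \<Rightarrow> 'a \<Rightarrow> 'k) \<Rightarrow> ('a \<Rightarrow> 'a \<Rightarrow> 'k)" where
  "lie_bracket f g = inc_mult f g - inc_mult g f"

definition unit_e :: "'a \<Rightarrow> 'a \<Rightarrow> ('a \<Rightarrow> 'a \<Rightarrow> 'k::field)" where
  "unit_e x y = (\<lambda>u v. if u = x \<and> v = y then 1 else 0)"

text \<open>Lie automorphisms: bijective K-linear maps of I(X,K) preserving the bracket
  (as elements of the bijection group, i.e. extensional outside I(X,K)).\<close>
definition is_lie_aut :: "(('a::order \<Rightarrow> 'a \<Rightarrow> 'k::field) \<Rightarrow> ('a \<Rightarrow> 'a \<Rightarrow> 'k)) \<Rightarrow> bool" where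
  "is_lie_aut \<phi> \<longleftrightarrow> \<phi> \<in> Bij Inc
     \<and> (\<forall>f\<in>Inc. \<forall>g\<in>Inc. \<phi> (f + g) = \<phi> f + \<phi> g)
     \<and> (\<forall>c. \<forall>f\<in>Inc. \<phi> (inc_smult c f) = inc_smult c (\<phi> f))
     \<and> (\<forall>f\<in>Inc. \<forall>g\<in>Inc. \<phi> (lie_bracket f g) = lie_bracket (\<phi> f) (\<phi> g))"

definition LAut :: "(('a::order \<Rightarrow> 'a \<Rightarrow> 'k::field) \<Rightarrow> ('a \<Rightarrow> 'a \<Rightarrow> 'k)) monoid" where
  "LAut = (BijGroup Inc) \<lparr>carrier := {\<phi>. is_lie_aut \<phi>}\<rparr>"

definition Inn1 :: "(('a::order \<Rightarrow> 'a \<Rightarrow> 'k::field) \<Rightarrow> ('a \<Rightarrow> 'a \<Rightarrow> 'k)) set" where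
  "Inn1 = {\<phi>. \<exists>\<beta>\<in>Inc. \<exists>\<gamma>\<in>Inc. (\<forall>x. \<beta> x x = 1)
              \<and> inc_mult \<beta> \<gamma> = inc_one \<and> inc_mult \<gamma> \<beta> = inc_one
              \<and> \<phi> = (\<lambda>f\<in>Inc. inc_mult (inc_mult \<beta> f) \<gamma>)}"

definition is_chain :: "'a::order set \<Rightarrow> bool" where
  "is_chain C \<longleftrightarrow> (\<forall>a\<in>C. \<forall>b\<in>C. a \<le> b \<or> b \<le> a)"

definition ell :: "'a::{order,finite} \<Rightarrow> 'a \<Rightarrow> nat" where
  "ell x y = Max {card C - 1 | C. C \<subseteq> {z. x \<le> z \<and> z \<le> y} \<and> C \<noteq> {} \<and> is_chain C}"

definition comp_L :: "nat \<Rightarrow> ('a::{order,finite} \<Rightarrow> 'a \<Rightarrow> 'k::field) \<Rightarrow> ('a \<Rightarrow> 'a \<Rightarrow> 'k)" where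
  "comp_L i g = (\<lambda>u v. if u \<le> v \<and> ell u v = i then g u v else 0)"

text \<open>tilde phi: the K-linear map with tilde phi (e_xy) = component in L_{l(x,y)} of phi(e_xy).\<close>
definition tilde :: "(('a::{order,finite} \<Rightarrow> 'a \<Rightarrow> 'k::field) \<Rightarrow> ('a \<Rightarrow> 'a \<Rightarrow> 'k))
                     \<Rightarrow> (('a \<Rightarrow> 'a \<Rightarrow> 'k) \<Rightarrow> ('a \<Rightarrow> 'a \<Rightarrow> 'k))" where
  "tilde \<phi> = (\<lambda>f\<in>Inc. \<Sum>p\<in>{(x,y). x \<le> y}.
                 inc_smult (f (fst p) (snd p)) (comp_L (ell (fst p) (snd p)) (\<phi> (unit_e (fst p) (snd p)))))"

definition LAut_tilde :: "(('a::{order,finite} \<Rightarrow> 'a \<Rightarrow> 'k::field) \<Rightarrow> ('a \<Rightarrow> 'a \<Rightarrow> 'k)) set" where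
  "LAut_tilde = tilde ` carrier LAut"

definition internal_semidirect :: "('g, 'b) monoid_scheme \<Rightarrow> 'g set \<Rightarrow> 'g set \<Rightarrow> bool" where
  "internal_semidirect G N H \<longleftrightarrow> group G \<and> normal N G \<and> subgroup H G
     \<and> N \<inter> H = {\<one>\<^bsub>G\<^esub>} \<and> N <#>\<^bsub>G\<^esub> H = carrier G"

end

theory Submission
  imports Defs
begin

text \<open>
  Let \<phi> be a Lie automorphism and D the diagonal subalgebra. Since D is its own centralizer for
  the bracket, so is A = \<phi>(D), which is therefore a commutative associative subalgebra. It meets
  the strictly triangular ideal trivially and maps onto D under taking diagonals, so the diagonal
  idempotents e_xx lift to orthogonal idempotents a_x in A. The unipotent element
  \<beta> = \<Sum> a_x e_xx satisfies a_x \<beta> = \<beta> e_xx, and its inverse is \<gamma> = \<Sum> e_xx a_x because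
  \<gamma>\<beta> = 1 and 1 - \<beta>\<gamma> is a strictly triangular idempotent.
  Thus \<epsilon>(f) = \<gamma> \<phi>(f) \<beta> is a Lie automorphism with \<epsilon>(D) = D. It permutes the root spaces of D,
  hence preserves every L_i, and as conjugation by \<beta> is the identity modulo higher terms, \<epsilon>
  equals the tilde of \<phi>. So LAut is the product of Inn_1 and the grading-preserving
  automorphisms, and Inn_1 consists of the automorphisms acting trivially on the associated
  graded space, which gives normality and the trivial intersection.
\<close>

notation inc_mult (infixl "\<star>" 70)

section \<open>The incidence algebra\<close>

lemma sum_fun_apply2: "(\<Sum>a\<in>A. F a) x y = (\<Sum>a\<in>A. F a x y)"
  by (induction A rule: infinite_finite_induct) auto

lemma Inc_zero: "0 \<in> Inc" and Inc_one: "inc_one \<in> Inc"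
  and Inc_add: "f \<in> Inc \<Longrightarrow> g \<in> Inc \<Longrightarrow> f + g \<in> Inc"
  and Inc_diff: "f \<in> Inc \<Longrightarrow> g \<in> Inc \<Longrightarrow> f - g \<in> Inc"
  and Inc_smult: "f \<in> Inc \<Longrightarrow> inc_smult c f \<in> Inc"
  and Inc_unit: "x \<le> y \<Longrightarrow> unit_e x y \<in> Inc"
  and Inc_comp_L: "comp_L i h0 \<in> Inc"
  and Inc_mult: "h \<star> h' \<in> Inc"
  by (auto simp: Inc_def inc_one_def inc_smult_def unit_e_def comp_L_def inc_mult_def
      intro!: sum.neutral)

lemma Inc_bracket: "lie_bracket f g \<in> Inc"
  unfolding lie_bracket_def by (intro Inc_diff Inc_mult)

lemma Inc_sum: "(\<And>a. a \<in> A \<Longrightarrow> F a \<in> Inc) \<Longrightarrow> (\<Sum>a\<in>A. F a) \<in> Inc"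
  by (induction A rule: infinite_finite_induct) (auto simp: Inc_zero intro: Inc_add)

lemmas Inc_intros = Inc_zero Inc_one Inc_add Inc_diff Inc_smult Inc_comp_L Inc_mult Inc_bracket Inc_sum

text \<open>Outside the interval one of the two factors vanishes. Once the index set no longer
  depends on \<open>x\<close> and \<open>y\<close>, associativity becomes an exchange of two
  sums.\<close>

lemma inc_mult_apply:
  fixes f g :: "'a::{order,finite} \<Rightarrow> 'a \<Rightarrow> 'k::field"
  assumes "f \<in> Inc" "g \<in> Inc"
  shows "(f \<star> g) x y = (\<Sum>t\<in>UNIV. f x t * g t y)"
  unfolding inc_mult_def using assms by (intro sum.mono_neutral_left) (auto simp: Inc_def)

lemma inc_mult_assoc:
  fixes f g h :: "'a::{order,finite} \<Rightarrow> 'a \<Rightarrow> 'k::field"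
  assumes "f \<in> Inc" "g \<in> Inc" "h \<in> Inc"
  shows "f \<star> g \<star> h = f \<star> (g \<star> h)"
proof (intro ext)
  fix x y
  have "(f \<star> g \<star> h) x y = (\<Sum>t\<in>UNIV. \<Sum>s\<in>UNIV. f x s * g s t * h t y)"
    using assms by (simp add: inc_mult_apply Inc_mult sum_distrib_right)
  also have "\<dots> = (\<Sum>s\<in>UNIV. \<Sum>t\<in>UNIV. f x s * g s t * h t y)"
    by (rule sum.swap)
  also have "\<dots> = (f \<star> (g \<star> h)) x y"
    using assms by (simp add: inc_mult_apply Inc_mult sum_distrib_left mult.assoc)
  finally show "(f \<star> g \<star> h) x y = (f \<star> (g \<star> h)) x y" .
qed

lemma inc_mult_one:
  fixes f :: "'a::{order,finite} \<Rightarrow> 'a \<Rightarrow> 'k::field"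
  assumes "f \<in> Inc"
  shows "inc_one \<star> f = f" "f \<star> inc_one = f"
proof -
  have "(\<Sum>t\<in>UNIV. (if x = t then 1 else 0) * f t y) = f x y" for x y
    by (subst sum.remove[of _ x]) auto
  then show "inc_one \<star> f = f"
    using assms by (intro ext) (simp add: inc_mult_apply Inc_one, simp add: inc_one_def)
  have "(\<Sum>t\<in>UNIV. f x t * (if t = y then 1 else 0)) = f x y" for x y
    by (subst sum.remove[of _ y]) auto
  then show "f \<star> inc_one = f"
    using assms by (intro ext) (simp add: inc_mult_apply Inc_one, simp add: inc_one_def)
qed

lemma inc_mult_linear:
  shows "f \<star> (g + h) = f \<star> g + f \<star> h" "(f + g) \<star> h = f \<star> h + g \<star> h"
    and "f \<star> (g - h) = f \<star> g - f \<star> h" "(f - g) \<star> h = f \<star> h - g \<star> h"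
    and "f \<star> inc_smult c g = inc_smult c (f \<star> g)" "inc_smult c f \<star> g = inc_smult c (f \<star> g)"
  by (auto simp: fun_eq_iff inc_mult_def inc_smult_def algebra_simps sum.distrib
      sum_subtractf sum_distrib_left)

lemma inc_mult_zero: "0 \<star> f = 0" "f \<star> 0 = 0"
  by (auto simp: fun_eq_iff inc_mult_def)

lemma inc_mult_sum:
  shows "f \<star> (\<Sum>a\<in>A. F a) = (\<Sum>a\<in>A. f \<star> F a)" "(\<Sum>a\<in>A. F a) \<star> f = (\<Sum>a\<in>A. F a \<star> f)"
  by (induction A rule: infinite_finite_induct) (auto simp: inc_mult_zero inc_mult_linear)

lemma inc_mult_diag: "(f \<star> g) x x = f x x * g x x"
proof -
  have "{t. x \<le> t \<and> t \<le> x} = {x}" by auto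
  then show ?thesis by (simp add: inc_mult_def)
qed

lemma unit_mult_unit:
  assumes "x \<le> y" "z \<le> w"
  shows "unit_e x y \<star> unit_e z w = (if y = z then unit_e x w else (0 :: 'a::{order,finite} \<Rightarrow> 'a \<Rightarrow> 'k::field))"
proof (intro ext)
  fix u v
  have "(unit_e x y \<star> unit_e z w) u v
      = (\<Sum>t\<in>UNIV. (unit_e x y u t * unit_e z w t v :: 'k))"
    using assms by (simp add: inc_mult_apply Inc_unit)
  also have "\<dots> = (\<Sum>t\<in>{y}. unit_e x y u t * unit_e z w t v)"
    by (rule sum.mono_neutral_right) (auto simp: unit_e_def)
  finally show "(unit_e x y \<star> unit_e z w) u v
      = (if y = z then unit_e x w else (0 :: 'a \<Rightarrow> 'a \<Rightarrow> 'k)) u v"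
    by (auto simp: unit_e_def)
qed

lemma Inc_expand:
  fixes f :: "'a::{order,finite} \<Rightarrow> 'a \<Rightarrow> 'k::field"
  assumes "f \<in> Inc"
  shows "f = (\<Sum>p\<in>{(x,y). x \<le> y}. inc_smult (f (fst p) (snd p)) (unit_e (fst p) (snd p)))"
proof (intro ext)
  fix u v
  have "(\<Sum>p\<in>{(x,y). x \<le> y}. f (fst p) (snd p) * unit_e (fst p) (snd p) u v) = f u v"
  proof (cases "u \<le> v")
    case True
    have "(\<Sum>p\<in>{(x,y). x \<le> y}. f (fst p) (snd p) * unit_e (fst p) (snd p) u v)
        = (\<Sum>p\<in>{(u,v)}. f (fst p) (snd p) * unit_e (fst p) (snd p) u v)"
      using True by (intro sum.mono_neutral_right) (auto simp: unit_e_def)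
    then show ?thesis by (simp add: unit_e_def)
  next
    case False
    then show ?thesis using assms
      by (auto simp: unit_e_def Inc_def intro!: sum.neutral)
  qed
  then show "f u v = (\<Sum>p\<in>{(x,y). x \<le> y}. inc_smult (f (fst p) (snd p)) (unit_e (fst p) (snd p))) u v"
    by (simp add: sum_fun_apply2 inc_smult_def)
qed

section \<open>Lengths of intervals and the induced filtration\<close>

lemma finite_chain_lengths:
  "finite {card C - 1 | C. C \<subseteq> {z::'a::{order,finite}. x \<le> z \<and> z \<le> y} \<and> C \<noteq> {} \<and> is_chain C}"
proof -
  have "finite ((\<lambda>C. card C - 1) ` (UNIV :: 'a set set))" by simp
  then show ?thesis by (rule rev_finite_subset) auto
qed

lemma ell_ge:
  assumes "C \<subseteq> {z. x \<le> z \<and> z \<le> y}" "C \<noteq> {}" "is_chain C"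
  shows "card C - 1 \<le> ell x y"
  unfolding ell_def using assms by (intro Max_ge finite_chain_lengths) auto

lemma ell_witness:
  assumes "x \<le> y"
  obtains C where "C \<subseteq> {z. x \<le> z \<and> z \<le> y}" "C \<noteq> {}" "is_chain C" "card C = Suc (ell x y)"
proof -
  let ?S = "{card C - 1 | C. C \<subseteq> {z. x \<le> z \<and> z \<le> y} \<and> C \<noteq> {} \<and> is_chain C}"
  have "{x} \<subseteq> {z. x \<le> z \<and> z \<le> y} \<and> {x} \<noteq> {} \<and> is_chain {x}"
    using assms by (auto simp: is_chain_def)
  then have "?S \<noteq> {}" by blast
  then have "ell x y \<in> ?S"
    unfolding ell_def by (intro Max_in finite_chain_lengths)
  then obtain C where C: "C \<subseteq> {z. x \<le> z \<and> z \<le> y}" "C \<noteq> {}" "is_chain C" "ell x y = card C - 1"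
    by blast
  \<comment> \<open>Subtraction on \<open>nat\<close> is truncated, so nonemptiness of
    \<open>C\<close> is what turns \<open>card C - 1\<close> into the \<open>Suc\<close>
    form.\<close>
  have "card C \<noteq> 0" using C(2) by simp
  with C that show thesis by auto
qed

lemma ell_refl: "ell x x = 0"
proof (rule ell_witness[of x x])
  fix C assume C: "C \<subseteq> {z. x \<le> z \<and> z \<le> x}" "C \<noteq> {}" "card C = Suc (ell x x)"
  have "C \<subseteq> {x}" using C(1) by auto
  then have "card C \<le> 1" using card_mono[of "{x}" C] by simp
  with C show ?thesis by simp
qed simp

lemma ell_pos:
  assumes "x < y"
  shows "0 < ell x y"
proof -
  have "card {x,y} - 1 \<le> ell x y"
    using assms by (intro ell_ge) (auto simp: is_chain_def)
  moreover have "card {x,y} = 2" using assms by (auto simp: card_insert_if)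
  ultimately show ?thesis by simp
qed

text \<open>The union of longest chains of the two halves is again a chain. The two chains share at
  most \<open>t\<close>, so the union has at least \<open>ell x t + ell t y + 1\<close>
  elements.\<close>

lemma ell_superadditive:
  assumes "x \<le> t" "t \<le> y"
  shows "ell x t + ell t y \<le> ell x y"
proof -
  obtain C where C: "C \<subseteq> {z. x \<le> z \<and> z \<le> t}" "C \<noteq> {}" "is_chain C" "card C = Suc (ell x t)"
    using ell_witness[OF assms(1)] .
  obtain E where E: "E \<subseteq> {z. t \<le> z \<and> z \<le> y}" "E \<noteq> {}" "is_chain E" "card E = Suc (ell t y)"
    using ell_witness[OF assms(2)] .
  have "a \<le> b" if "a \<in> C" "b \<in> E" for a b
    using that C(1) E(1) by (auto intro: order_trans)
  then have "is_chain (C \<union> E)"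
    using C(3) E(3) unfolding is_chain_def by blast
  moreover have "C \<union> E \<subseteq> {z. x \<le> z \<and> z \<le> y}"
    using C(1) E(1) assms by (auto intro: order_trans)
  ultimately have "card (C \<union> E) - 1 \<le> ell x y"
    using C(2) by (intro ell_ge) auto
  moreover have "C \<inter> E \<subseteq> {t}" using C(1) E(1) by (auto intro: order.antisym)
  then have "card (C \<inter> E) \<le> 1" using card_mono[of "{t}" "C \<inter> E"] by simp
  moreover have "card C + card E = card (C \<union> E) + card (C \<inter> E)"
    by (rule card_Un_Int) auto
  ultimately show ?thesis using C(4) E(4) by linarith
qed

lemma finite_chain_least:
  fixes C :: "'a::order set"
  assumes "finite C" "C \<noteq> {}" "is_chain C"
  obtains m where "m \<in> C" "\<And>z. z \<in> C \<Longrightarrow> m \<le> z"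
proof -
  obtain m where m: "m \<in> C" "\<And>b. b \<in> C \<Longrightarrow> b \<le> m \<Longrightarrow> m = b"
    using finite_has_minimal[OF assms(1,2)] by blast
  have "m \<le> z" if "z \<in> C" for z
    using m that assms(3) unfolding is_chain_def by (metis order_refl)
  with m(1) that show thesis by blast
qed

text \<open>Remove the least element \<open>m\<close> of a longest chain and let \<open>z\<close> be
  the least of the remaining ones. Since \<open>m\<close> is at least \<open>x\<close>,
  \<open>z\<close> lies strictly above \<open>x\<close> even if \<open>m\<close> differs from
  \<open>x\<close>. This drives the induction that peels brackets off a matrix unit.\<close>

lemma ell_SucE:
  assumes "x \<le> y" "ell x y = Suc n"
  obtains z where "x < z" "z \<le> y" "n \<le> ell z y"
proof -
  obtain C where C: "C \<subseteq> {z. x \<le> z \<and> z \<le> y}" "C \<noteq> {}" "is_chain C" "card C = Suc (ell x y)"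
    using ell_witness[OF assms(1)] .
  obtain m where m: "m \<in> C" "\<And>z. z \<in> C \<Longrightarrow> m \<le> z"
    using finite_chain_least[OF _ C(2,3)] by auto
  have card: "card (C - {m}) = Suc n" using C(4) m(1) assms(2) by simp
  then have ne: "C - {m} \<noteq> {}" by (metis card.empty nat.distinct(1))
  have ch: "is_chain (C - {m})" using C(3) by (auto simp: is_chain_def)
  obtain z where z: "z \<in> C - {m}" "\<And>w. w \<in> C - {m} \<Longrightarrow> z \<le> w"
    using finite_chain_least[OF _ ne ch] by auto
  have "x \<le> m" "m < z" "z \<le> y" using C(1) m z(1) by (auto simp: less_le)
  moreover have "card (C - {m}) - 1 \<le> ell z y"
    using C(1) z(2) ne ch by (intro ell_ge) auto
  ultimately show thesis using card that by (metis diff_Suc_1 le_less_trans)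
qed

text \<open>\<open>Fil i\<close> is the sum of the \<open>L_k\<close> with \<open>k \<ge> i\<close>.
  Membership in \<open>Inc\<close> guards the length condition, because \<open>ell x y\<close> is
  the maximum of an empty set when \<open>x \<le> y\<close> fails.\<close>

definition Fil :: "nat \<Rightarrow> ('a::{order,finite} \<Rightarrow> 'a \<Rightarrow> 'k::field) set" where
  "Fil i = {f\<in>Inc. \<forall>x y. f x y \<noteq> 0 \<longrightarrow> i \<le> ell x y}"

lemma Fil_Inc: "f \<in> Fil i \<Longrightarrow> f \<in> Inc"
  by (simp add: Fil_def)

lemma Fil_0: "Fil 0 = Inc"
  by (auto simp: Fil_def)

lemma Fil_add: "f \<in> Fil i \<Longrightarrow> g \<in> Fil i \<Longrightarrow> f + g \<in> Fil i"
  by (simp add: Fil_def Inc_add) (metis add_0)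

lemma Fil_diff: "f \<in> Fil i \<Longrightarrow> g \<in> Fil i \<Longrightarrow> f - g \<in> Fil i"
  by (simp add: Fil_def Inc_diff) (metis diff_self)

lemma Fil_smult: "f \<in> Fil i \<Longrightarrow> inc_smult c f \<in> Fil i"
  by (auto simp: Fil_def Inc_smult) (simp add: inc_smult_def)

lemma Fil_zero: "0 \<in> Fil i"
  by (simp add: Fil_def Inc_zero)

lemma Fil_sum: "(\<And>a. a \<in> A \<Longrightarrow> F a \<in> Fil i) \<Longrightarrow> (\<Sum>a\<in>A. F a) \<in> Fil i"
  by (induction A rule: infinite_finite_induct) (auto simp: Fil_zero intro: Fil_add)

lemma Fil_antimono: "f \<in> Fil j \<Longrightarrow> i \<le> j \<Longrightarrow> f \<in> Fil i"
  by (fastforce simp: Fil_def)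

text \<open>A nonzero entry of the product needs some \<open>t\<close> at which both factors are
  nonzero, and superadditivity adds up the two lengths.\<close>

lemma Fil_mult:
  assumes "f \<in> Fil i" "g \<in> Fil j"
  shows "f \<star> g \<in> Fil (i + j)"
proof -
  have "i + j \<le> ell x y" if nz: "(f \<star> g) x y \<noteq> 0" for x y
  proof -
    obtain t where t: "x \<le> t" "t \<le> y" "f x t * g t y \<noteq> 0"
      using sum.not_neutral_contains_not_neutral[OF nz[unfolded inc_mult_def]] by blast
    then have "i \<le> ell x t" "j \<le> ell t y" using assms by (auto simp: Fil_def)
    with ell_superadditive[OF t(1,2)] show ?thesis by linarith
  qed
  then show ?thesis by (auto simp: Fil_def Inc_mult)
qed

lemma Fil_bracket: "f \<in> Fil i \<Longrightarrow> g \<in> Fil j \<Longrightarrow> lie_bracket f g \<in> Fil (i + j)"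
  unfolding lie_bracket_def by (metis Fil_diff Fil_mult add.commute)

text \<open>The strictly triangular ideal is the first step of the filtration, because an interval
  has length zero exactly when its endpoints agree.\<close>

lemma Fil_1_iff: "f \<in> Fil (Suc 0) \<longleftrightarrow> f \<in> Inc \<and> (\<forall>x. f x x = 0)"
proof
  assume "f \<in> Fil (Suc 0)"
  then have "f \<in> Inc" "\<And>x. f x x \<noteq> 0 \<Longrightarrow> Suc 0 \<le> ell x x" by (auto simp: Fil_def)
  then show "f \<in> Inc \<and> (\<forall>x. f x x = 0)" by (auto simp: ell_refl)
next
  assume f: "f \<in> Inc \<and> (\<forall>x. f x x = 0)"
  have "Suc 0 \<le> ell x y" if "f x y \<noteq> 0" for x y
  proof -
    have "x \<le> y" "x \<noteq> y" using f that by (auto simp: Inc_def)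
    then have "x < y" by simp
    then show ?thesis using ell_pos[of x y] by simp
  qed
  with f show "f \<in> Fil (Suc 0)" by (auto simp: Fil_def)
qed

lemma Fil_unit: "x \<le> y \<Longrightarrow> unit_e x y \<in> Fil (ell x y)"
  by (simp add: Fil_def Inc_unit) (simp add: unit_e_def)

text \<open>An idempotent equals all its powers, so it lies in every \<open>Fil n\<close>. The entry
  at \<open>x\<close>, \<open>y\<close> is excluded by any \<open>n\<close> above
  \<open>ell x y\<close>.\<close>

lemma Fil_idempotent_zero:
  assumes p: "p \<in> Fil (Suc 0)" and idem: "p \<star> p = p"
  shows "p = 0"
proof -
  have "p \<in> Fil n" for n
  proof (induction n)
    case 0
    show ?case using p by (simp add: Fil_0 Fil_Inc)
  next
    case (Suc n)
    from Fil_mult[OF p this] show ?case by (simp add: idem)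
  qed
  then have "p x y = 0" for x y
    by (metis (mono_tags, lifting) Fil_def mem_Collect_eq not_less_eq_eq order_refl)
  then show ?thesis by (simp add: fun_eq_iff)
qed

lemma comp_L_Fil: "comp_L i f \<in> Fil i"
  by (simp add: Fil_def Inc_comp_L) (simp add: comp_L_def)

lemma Fil_diff_comp_L:
  assumes "f \<in> Fil i"
  shows "f - comp_L i f \<in> Fil (Suc i)"
proof -
  have "Suc i \<le> ell x y" if "(f - comp_L i f) x y \<noteq> 0" for x y
  proof -
    have "x \<le> y" using that assms by (auto simp: Fil_def Inc_def comp_L_def split: if_splits)
    with that have "f x y \<noteq> 0" "ell x y \<noteq> i" by (auto simp: comp_L_def split: if_splits)
    moreover from \<open>f x y \<noteq> 0\<close> have "i \<le> ell x y" using assms by (auto simp: Fil_def)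
    ultimately show ?thesis by simp
  qed
  moreover have "f - comp_L i f \<in> Inc" using assms by (intro Inc_diff Inc_comp_L Fil_Inc)
  ultimately show ?thesis unfolding Fil_def by blast
qed

lemma comp_L_linear:
  shows "comp_L i (f + g) = comp_L i f + comp_L i g"
    and "comp_L i (inc_smult c f) = inc_smult c (comp_L i f)"
  by (auto simp: fun_eq_iff comp_L_def inc_smult_def)

lemma comp_L_sum: "comp_L i (\<Sum>a\<in>A. F a) = (\<Sum>a\<in>A. comp_L i (F a))"
  by (intro ext) (auto simp: sum_fun_apply2 comp_L_def intro: sum.neutral)

lemma comp_L_unit: "x \<le> y \<Longrightarrow> comp_L i (unit_e x y) = (if ell x y = i then unit_e x y else 0)"
  by (auto simp: fun_eq_iff comp_L_def unit_e_def)

lemma comp_L_apply: "f \<in> Inc \<Longrightarrow> comp_L (ell u v) f u v = f u v"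
  by (auto simp: comp_L_def Inc_def)

section \<open>Diagonal elements\<close>

definition Diag :: "('a::order \<Rightarrow> 'a \<Rightarrow> 'k::field) set" where
  "Diag = {f. \<forall>x y. x \<noteq> y \<longrightarrow> f x y = 0}"

lemma Diag_Inc: "f \<in> Diag \<Longrightarrow> f \<in> Inc"
  by (auto simp: Diag_def Inc_def)

lemma Diag_unit: "unit_e x x \<in> Diag"
  by (auto simp: Diag_def unit_e_def)

lemma comp_L_0_apply: "comp_L 0 f x y = (if x = y then f x x else 0)"
  using ell_pos[of x y] by (auto simp: comp_L_def ell_refl order.order_iff_strict)

lemma comp_L_of_Diag:
  assumes "h \<in> Diag"
  shows "comp_L i h = (if i = 0 then h else 0)"
proof (intro ext)
  fix u v
  show "comp_L i h u v = (if i = 0 then h else 0) u v"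
    using assms by (cases "u = v") (auto simp: comp_L_def Diag_def ell_refl)
qed

lemma comp_L_Diag: "comp_L 0 f \<in> Diag"
  by (auto simp: Diag_def comp_L_0_apply)

lemma Diag_mult_left:
  fixes f d :: "'a::{order,finite} \<Rightarrow> 'a \<Rightarrow> 'k::field"
  assumes "d \<in> Diag" "f \<in> Inc"
  shows "(d \<star> f) u v = d u u * f u v"
proof -
  have "(d \<star> f) u v = (\<Sum>t\<in>UNIV. d u t * f t v)"
    using assms by (simp add: inc_mult_apply Diag_Inc)
  also have "\<dots> = (\<Sum>t\<in>{u}. d u t * f t v)"
    using assms by (intro sum.mono_neutral_right) (auto simp: Diag_def)
  finally show ?thesis by simp
qed

lemma Diag_mult_right:
  fixes f d :: "'a::{order,finite} \<Rightarrow> 'a \<Rightarrow> 'k::field"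
  assumes "d \<in> Diag" "f \<in> Inc"
  shows "(f \<star> d) u v = f u v * d v v"
proof -
  have "(f \<star> d) u v = (\<Sum>t\<in>UNIV. f u t * d t v)"
    using assms by (simp add: inc_mult_apply Diag_Inc)
  also have "\<dots> = (\<Sum>t\<in>{v}. f u t * d t v)"
    using assms by (intro sum.mono_neutral_right) (auto simp: Diag_def)
  finally show ?thesis by simp
qed

text \<open>Matrix units are weight vectors for the adjoint action of the diagonal, and the position
  \<open>(u, v)\<close> carries the weight \<open>d u u - d v v\<close>.\<close>

lemma Diag_bracket_apply:
  fixes f d :: "'a::{order,finite} \<Rightarrow> 'a \<Rightarrow> 'k::field"
  assumes "d \<in> Diag" "f \<in> Inc"
  shows "lie_bracket d f u v = (d u u - d v v) * f u v"
  using assms by (simp add: lie_bracket_def Diag_mult_left Diag_mult_right algebra_simps)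

lemma Diag_bracket_Diag:
  assumes "d \<in> Diag" "d' \<in> Diag"
  shows "lie_bracket d d' = (0 :: 'a::{order,finite} \<Rightarrow> 'a \<Rightarrow> 'k::field)"
proof (intro ext)
  fix u v
  show "lie_bracket d d' u v = 0 u v"
    using assms by (cases "u = v") (auto simp: Diag_bracket_apply Diag_Inc, auto simp: Diag_def)
qed

text \<open>Bracketing with \<open>unit_e u u\<close> multiplies an entry at \<open>(u, v)\<close>
  with \<open>v \<noteq> u\<close> by 1, in every characteristic, so a vanishing bracket kills
  it.\<close>

lemma Diag_self_centralizing:
  fixes f :: "'a::{order,finite} \<Rightarrow> 'a \<Rightarrow> 'k::field"
  assumes "f \<in> Inc" "\<And>x. lie_bracket (unit_e x x) f = 0"
  shows "f \<in> Diag"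
proof -
  have "f u v = 0" if "u \<noteq> v" for u v
    using Diag_bracket_apply[OF Diag_unit[of u] assms(1), of u v] assms(2)[of u] that
    by (simp add: unit_e_def)
  then show ?thesis by (simp add: Diag_def)
qed

section \<open>Lie automorphisms\<close>

lemma lie_aut_Inc: "is_lie_aut \<phi> \<Longrightarrow> f \<in> Inc \<Longrightarrow> \<phi> f \<in> Inc"
  by (auto simp: is_lie_aut_def Bij_def bij_betw_def)

lemma lie_aut_add: "is_lie_aut \<phi> \<Longrightarrow> f \<in> Inc \<Longrightarrow> g \<in> Inc \<Longrightarrow> \<phi> (f + g) = \<phi> f + \<phi> g"
  by (simp add: is_lie_aut_def)

lemma lie_aut_smult: "is_lie_aut \<phi> \<Longrightarrow> f \<in> Inc \<Longrightarrow> \<phi> (inc_smult c f) = inc_smult c (\<phi> f)"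
  by (simp add: is_lie_aut_def)

lemma lie_aut_bracket:
  "is_lie_aut \<phi> \<Longrightarrow> f \<in> Inc \<Longrightarrow> g \<in> Inc \<Longrightarrow> \<phi> (lie_bracket f g) = lie_bracket (\<phi> f) (\<phi> g)"
  by (simp add: is_lie_aut_def)

lemma lie_aut_inj: "is_lie_aut \<phi> \<Longrightarrow> f \<in> Inc \<Longrightarrow> g \<in> Inc \<Longrightarrow> \<phi> f = \<phi> g \<Longrightarrow> f = g"
  by (auto simp: is_lie_aut_def Bij_def bij_betw_def dest: inj_onD)

lemma lie_aut_ext: "is_lie_aut \<phi> \<Longrightarrow> \<phi> \<in> extensional Inc"
  by (auto simp: is_lie_aut_def Bij_def)

lemma lie_aut_zero: "is_lie_aut \<phi> \<Longrightarrow> \<phi> 0 = 0"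
  using lie_aut_add[of \<phi> 0 0] by (simp add: Inc_zero)

lemma lie_aut_diff:
  assumes "is_lie_aut \<phi>" "f \<in> Inc" "g \<in> Inc"
  shows "\<phi> (f - g) = \<phi> f - \<phi> g"
  using lie_aut_add[OF assms(1) Inc_diff[OF assms(2,3)] assms(3)] by (simp add: algebra_simps)

lemma lie_aut_sum:
  assumes "is_lie_aut \<phi>" "\<And>a. a \<in> A \<Longrightarrow> F a \<in> Inc"
  shows "\<phi> (\<Sum>a\<in>A. F a) = (\<Sum>a\<in>A. \<phi> (F a))"
  using assms(2)
  by (induction A rule: infinite_finite_induct)
    (auto simp: lie_aut_zero[OF assms(1)] lie_aut_add[OF assms(1)] Inc_sum)

lemma lie_aut_expand:
  fixes f :: "'a::{order,finite} \<Rightarrow> 'a \<Rightarrow> 'k::field"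
  assumes "is_lie_aut \<phi>" "f \<in> Inc"
  shows "\<phi> f = (\<Sum>p\<in>{(x,y). x \<le> y}. inc_smult (f (fst p) (snd p)) (\<phi> (unit_e (fst p) (snd p))))"
proof -
  have "\<phi> f = \<phi> (\<Sum>p\<in>{(x,y). x \<le> y}. inc_smult (f (fst p) (snd p)) (unit_e (fst p) (snd p)))"
    by (rule arg_cong[OF Inc_expand[OF assms(2)]])
  also have "\<dots> = (\<Sum>p\<in>{(x,y). x \<le> y}. \<phi> (inc_smult (f (fst p) (snd p)) (unit_e (fst p) (snd p))))"
    by (rule lie_aut_sum[OF assms(1)]) (auto intro!: Inc_smult Inc_unit)
  also have "\<dots> = (\<Sum>p\<in>{(x,y). x \<le> y}. inc_smult (f (fst p) (snd p)) (\<phi> (unit_e (fst p) (snd p))))"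
    by (rule sum.cong[OF refl]) (auto intro!: lie_aut_smult[OF assms(1)] Inc_unit)
  finally show ?thesis .
qed

text \<open>The map \<open>\<psi>\<close> only certifies bijectivity; neither linearity nor
  extensionality is asked of it.\<close>

lemma lie_autI:
  assumes "\<phi> \<in> extensional Inc" "\<And>f. f \<in> Inc \<Longrightarrow> \<phi> f \<in> Inc" "\<And>f. f \<in> Inc \<Longrightarrow> \<psi> f \<in> Inc"
    and "\<And>f. f \<in> Inc \<Longrightarrow> \<psi> (\<phi> f) = f" "\<And>f. f \<in> Inc \<Longrightarrow> \<phi> (\<psi> f) = f"
    and "\<And>f g. f \<in> Inc \<Longrightarrow> g \<in> Inc \<Longrightarrow> \<phi> (f + g) = \<phi> f + \<phi> g"
    and "\<And>c f. f \<in> Inc \<Longrightarrow> \<phi> (inc_smult c f) = inc_smult c (\<phi> f)"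
    and "\<And>f g. f \<in> Inc \<Longrightarrow> g \<in> Inc \<Longrightarrow> \<phi> (lie_bracket f g) = lie_bracket (\<phi> f) (\<phi> g)"
  shows "is_lie_aut \<phi>"
proof -
  have "bij_betw \<phi> Inc Inc"
    by (rule bij_betw_byWitness[where f' = \<psi>]) (use assms in auto)
  with assms show ?thesis by (simp add: is_lie_aut_def Bij_def)
qed

text \<open>Restricting to \<open>Inc\<close> makes the inverse extensional, as elements of
  \<open>BijGroup\<close> are. Each law for \<open>\<psi>\<close> is checked after applying the
  injective \<open>\<phi>\<close>.\<close>

lemma lie_aut_inverse:
  fixes \<phi> :: "('a::order \<Rightarrow> 'a \<Rightarrow> 'k::field) \<Rightarrow> ('a \<Rightarrow> 'a \<Rightarrow> 'k)"
  assumes "is_lie_aut \<phi>"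
  defines "\<psi> \<equiv> restrict (inv_into Inc \<phi>) Inc"
  shows "is_lie_aut \<psi>" "f \<in> Inc \<Longrightarrow> \<phi> (\<psi> f) = f" "f \<in> Inc \<Longrightarrow> \<psi> (\<phi> f) = f"
proof -
  have bij: "bij_betw \<phi> Inc Inc" using assms(1) by (simp add: is_lie_aut_def Bij_def)
  have in1: "\<psi> f \<in> Inc" if "f \<in> Inc" for f
    using that bij by (simp add: \<psi>_def bij_betw_def inv_into_into)
  have r: "\<phi> (\<psi> f) = f" if "f \<in> Inc" for f
    using that bij by (simp add: \<psi>_def bij_betw_inv_into_right)
  have l: "\<psi> (\<phi> f) = f" if "f \<in> Inc" for f
    using that bij lie_aut_Inc[OF assms(1)] by (simp add: \<psi>_def bij_betw_inv_into_left)
  note ax = lie_aut_add[OF assms(1)] lie_aut_smult[OF assms(1)] lie_aut_bracket[OF assms(1)]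
  show "is_lie_aut \<psi>"
  proof (rule lie_autI[where \<psi> = \<phi>])
    fix f g :: "'a \<Rightarrow> 'a \<Rightarrow> 'k" and c
    assume f: "f \<in> Inc"
    show "\<psi> (inc_smult c f) = inc_smult c (\<psi> f)"
      by (rule lie_aut_inj[OF assms(1)]) (use f in1 in \<open>simp_all add: ax r Inc_smult\<close>)
    assume g: "g \<in> Inc"
    show "\<psi> (f + g) = \<psi> f + \<psi> g"
      by (rule lie_aut_inj[OF assms(1)]) (use f g in1 in \<open>simp_all add: ax r Inc_add\<close>)
    show "\<psi> (lie_bracket f g) = lie_bracket (\<psi> f) (\<psi> g)"
      by (rule lie_aut_inj[OF assms(1)]) (use f g in1 in \<open>simp_all add: ax r Inc_bracket\<close>)
  qed (use in1 r l lie_aut_Inc[OF assms(1)] in \<open>auto simp: \<psi>_def\<close>)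
  show "f \<in> Inc \<Longrightarrow> \<phi> (\<psi> f) = f" "f \<in> Inc \<Longrightarrow> \<psi> (\<phi> f) = f" by (fact r l)+
qed

lemma lie_aut_compose:
  assumes "is_lie_aut \<phi>" "is_lie_aut \<psi>"
  shows "is_lie_aut (compose Inc \<phi> \<psi>)"
proof -
  have "compose Inc \<phi> \<psi> \<in> Bij Inc"
    using assms by (auto simp: is_lie_aut_def intro: compose_Bij)
  with assms show ?thesis
    by (auto simp: is_lie_aut_def compose_eq Inc_add Inc_smult Inc_bracket
        lie_aut_Inc[OF assms(1)] lie_aut_Inc[OF assms(2)])
qed

lemma lie_aut_id: "is_lie_aut (\<lambda>f\<in>Inc. f)"
  by (rule lie_autI[where \<psi> = "\<lambda>f. f"]) (auto simp: Inc_add Inc_smult Inc_bracket)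

text \<open>The terms of the filtration are the terms of the lower central series of the
  commutator ideal, so they are invariant.\<close>

lemma lie_aut_unit_Fil:
  fixes \<phi> :: "('a::{order,finite} \<Rightarrow> 'a \<Rightarrow> 'k::field) \<Rightarrow> ('a \<Rightarrow> 'a \<Rightarrow> 'k)"
  assumes \<phi>: "is_lie_aut \<phi>" and "x \<le> y"
  shows "\<phi> (unit_e x y) \<in> Fil (ell x y)"
proof -
  have strict: "\<phi> (unit_e x y) \<in> Fil (Suc 0)" if "x < y" for x y :: 'a
  proof -
    \<comment> \<open>The unit is itself a bracket, and every bracket has zero diagonal, because
      diagonal entries multiply in the commutative field.\<close>
    have "lie_bracket (unit_e x x) (unit_e x y) = (unit_e x y :: 'a \<Rightarrow> 'a \<Rightarrow> 'k)"
      using that by (simp add: lie_bracket_def unit_mult_unit)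
    then have "\<phi> (unit_e x y) = lie_bracket (\<phi> (unit_e x x)) (\<phi> (unit_e x y))"
      using that lie_aut_bracket[OF \<phi>, of "unit_e x x" "unit_e x y"] by (simp add: Inc_unit)
    also have "\<dots> \<in> Fil (Suc 0)"
      by (auto simp: Fil_1_iff Inc_bracket) (simp add: lie_bracket_def inc_mult_diag)
    finally show ?thesis .
  qed
  have "\<phi> (unit_e x y) \<in> Fil n" if "x \<le> y" "n \<le> ell x y" for n x y
    using that
  proof (induction n arbitrary: x y)
    case 0
    then show ?case by (simp add: Fil_0 lie_aut_Inc[OF \<phi>] Inc_unit)
  next
    case (Suc n)
    \<comment> \<open>The premise \<open>Suc n \<le> ell x y\<close> makes the length positive, so
      \<open>ell x y - 1\<close> is a true predecessor. Then \<open>unit_e x y\<close> is the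
      bracket of \<open>unit_e x z\<close> and \<open>unit_e z y\<close>, whose images lie in
      \<open>Fil (Suc 0)\<close> and \<open>Fil n\<close>.\<close>
    then obtain z where z: "x < z" "z \<le> y" "ell x y - 1 \<le> ell z y"
      using ell_SucE[of x y "ell x y - 1"] by auto
    then have n: "n \<le> ell z y" using Suc.prems by simp
    have "lie_bracket (unit_e x z) (unit_e z y) = (unit_e x y :: 'a \<Rightarrow> 'a \<Rightarrow> 'k)"
      using z by (auto simp: lie_bracket_def unit_mult_unit)
    then have "\<phi> (unit_e x y) = lie_bracket (\<phi> (unit_e x z)) (\<phi> (unit_e z y))"
      using z lie_aut_bracket[OF \<phi>, of "unit_e x z" "unit_e z y"] by (simp add: Inc_unit)
    also have "\<dots> \<in> Fil (Suc 0 + n)"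
      by (intro Fil_bracket strict Suc.IH z n)
    finally show ?case by simp
  qed
  with assms(2) show ?thesis by simp
qed

lemma lie_aut_Fil:
  fixes \<phi> :: "('a::{order,finite} \<Rightarrow> 'a \<Rightarrow> 'k::field) \<Rightarrow> ('a \<Rightarrow> 'a \<Rightarrow> 'k)"
  assumes \<phi>: "is_lie_aut \<phi>" and f: "f \<in> Fil i"
  shows "\<phi> f \<in> Fil i"
proof -
  \<comment> \<open>A vanishing coefficient needs its own case: the length \<open>ell x y\<close>
    may then be below \<open>i\<close>.\<close>
  have "inc_smult (f x y) (\<phi> (unit_e x y)) \<in> Fil i" if "x \<le> y" for x y
  proof (cases "f x y = 0")
    case True
    then have "inc_smult (f x y) (\<phi> (unit_e x y)) = 0" by (simp add: inc_smult_def fun_eq_iff)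
    then show ?thesis by (simp add: Fil_zero)
  next
    case False
    then have "i \<le> ell x y" using f by (auto simp: Fil_def)
    then show ?thesis
      using Fil_smult Fil_antimono lie_aut_unit_Fil[OF \<phi> that] by blast
  qed
  then show ?thesis
    by (subst lie_aut_expand[OF \<phi> Fil_Inc[OF f]]) (auto intro!: Fil_sum)
qed

section \<open>Automorphisms that respect the grading, and the map \<open>tilde\<close>\<close>

definition graded :: "(('a::{order,finite} \<Rightarrow> 'a \<Rightarrow> 'k::field) \<Rightarrow> ('a \<Rightarrow> 'a \<Rightarrow> 'k)) \<Rightarrow> bool" where
  "graded \<epsilon> \<longleftrightarrow> (\<forall>i. \<forall>f\<in>Inc. \<epsilon> (comp_L i f) = comp_L i (\<epsilon> f))"

lemma graded_compose:
  assumes "is_lie_aut \<phi>" "graded \<phi>" "is_lie_aut \<psi>" "graded \<psi>"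
  shows "graded (compose Inc \<phi> \<psi>)"
  using assms by (simp add: graded_def compose_eq Inc_comp_L lie_aut_Inc)

lemma graded_inverse:
  fixes \<phi> :: "('a::{order,finite} \<Rightarrow> 'a \<Rightarrow> 'k::field) \<Rightarrow> ('a \<Rightarrow> 'a \<Rightarrow> 'k)"
  assumes "is_lie_aut \<phi>" "graded \<phi>"
  shows "graded (restrict (inv_into Inc \<phi>) Inc)"
  unfolding graded_def
proof (intro allI ballI)
  fix i and f :: "'a \<Rightarrow> 'a \<Rightarrow> 'k" assume f: "f \<in> Inc"
  let ?\<psi> = "restrict (inv_into Inc \<phi>) Inc"
  note inv = lie_aut_inverse[OF assms(1)]
  have "\<phi> (?\<psi> (comp_L i f)) = \<phi> (comp_L i (?\<psi> f))"
    using assms(2) lie_aut_Inc[OF inv(1) f]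
    by (simp only: graded_def inv(2)[OF Inc_comp_L] inv(2)[OF f])
  then show "?\<psi> (comp_L i f) = comp_L i (?\<psi> f)"
    using lie_aut_inj[OF assms(1)] lie_aut_Inc[OF inv(1)] Inc_comp_L f by blast
qed

text \<open>At the entry \<open>(u, v)\<close> only basis elements of length \<open>ell u v\<close>
  survive the projections. By linearity they assemble to \<open>\<phi>\<close> applied to one
  homogeneous component of \<open>f\<close>.\<close>

lemma tilde_apply:
  assumes \<phi>: "is_lie_aut \<phi>" and f: "f \<in> Inc"
  shows "tilde \<phi> f u v = (if u \<le> v then \<phi> (comp_L (ell u v) f) u v else 0)"
proof -
  let ?P = "{(x::'a, y). x \<le> y}"
  have "tilde \<phi> f u v
      = (\<Sum>p\<in>?P. f (fst p) (snd p) * comp_L (ell (fst p) (snd p)) (\<phi> (unit_e (fst p) (snd p))) u v)"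
    using f by (simp add: tilde_def sum_fun_apply2 inc_smult_def)
  also have "\<dots> = (if u \<le> v then \<Sum>p\<in>?P. comp_L (ell u v) f (fst p) (snd p) * \<phi> (unit_e (fst p) (snd p)) u v else 0)"
    by (auto simp: comp_L_def intro!: sum.cong sum.neutral)
  also have "\<dots> = (if u \<le> v then \<phi> (comp_L (ell u v) f) u v else 0)"
    by (subst lie_aut_expand[OF \<phi> Inc_comp_L]) (simp add: sum_fun_apply2 inc_smult_def)
  finally show ?thesis .
qed

section \<open>Unipotent conjugations\<close>

lemma conj_inverse:
  fixes f :: "'a::{order,finite} \<Rightarrow> 'a \<Rightarrow> 'k::field"
  assumes "\<beta> \<in> Inc" "\<gamma> \<in> Inc" "\<gamma> \<star> \<beta> = inc_one" "f \<in> Inc"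
  shows "\<gamma> \<star> (\<beta> \<star> f \<star> \<gamma>) \<star> \<beta> = f"
proof -
  have "\<gamma> \<star> (\<beta> \<star> f \<star> \<gamma>) \<star> \<beta> = (\<gamma> \<star> \<beta>) \<star> f \<star> (\<gamma> \<star> \<beta>)"
    using assms(1,2,4) by (simp add: inc_mult_assoc Inc_mult)
  then show ?thesis using assms by (simp add: inc_mult_one)
qed

lemma conj_mult:
  fixes f g :: "'a::{order,finite} \<Rightarrow> 'a \<Rightarrow> 'k::field"
  assumes "\<beta> \<in> Inc" "\<gamma> \<in> Inc" "\<gamma> \<star> \<beta> = inc_one" "f \<in> Inc" "g \<in> Inc"
  shows "(\<beta> \<star> f \<star> \<gamma>) \<star> (\<beta> \<star> g \<star> \<gamma>) = \<beta> \<star> (f \<star> g) \<star> \<gamma>"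
proof -
  have "(\<beta> \<star> f \<star> \<gamma>) \<star> (\<beta> \<star> g \<star> \<gamma>) = \<beta> \<star> f \<star> (\<gamma> \<star> \<beta>) \<star> g \<star> \<gamma>"
    using assms(1,2,4,5) by (simp add: inc_mult_assoc Inc_mult)
  then show ?thesis using assms by (simp add: inc_mult_one inc_mult_assoc Inc_mult)
qed

lemma conj_lie_aut:
  fixes \<beta> \<gamma> :: "'a::{order,finite} \<Rightarrow> 'a \<Rightarrow> 'k::field"
  assumes "\<beta> \<in> Inc" "\<gamma> \<in> Inc" "\<gamma> \<star> \<beta> = inc_one" "\<beta> \<star> \<gamma> = inc_one"
  shows "is_lie_aut (\<lambda>f\<in>Inc. \<beta> \<star> f \<star> \<gamma>)"
proof (rule lie_autI[where \<psi> = "\<lambda>f. \<gamma> \<star> f \<star> \<beta>"])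
  fix f g :: "'a \<Rightarrow> 'a \<Rightarrow> 'k" assume fg: "f \<in> Inc" "g \<in> Inc"
  have "(\<beta> \<star> f \<star> \<gamma>) \<star> (\<beta> \<star> g \<star> \<gamma>) = \<beta> \<star> (f \<star> g) \<star> \<gamma>"
    "(\<beta> \<star> g \<star> \<gamma>) \<star> (\<beta> \<star> f \<star> \<gamma>) = \<beta> \<star> (g \<star> f) \<star> \<gamma>"
    by (intro conj_mult assms fg)+
  then show "(\<lambda>f\<in>Inc. \<beta> \<star> f \<star> \<gamma>) (lie_bracket f g)
      = lie_bracket ((\<lambda>f\<in>Inc. \<beta> \<star> f \<star> \<gamma>) f) ((\<lambda>f\<in>Inc. \<beta> \<star> f \<star> \<gamma>) g)"
    using fg by (simp add: Inc_bracket) (simp add: lie_bracket_def inc_mult_linear)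
qed (use assms in \<open>auto simp: Inc_intros conj_inverse inc_mult_linear\<close>)

lemma Inn1_lie_aut:
  fixes \<psi> :: "('a::{order,finite} \<Rightarrow> 'a \<Rightarrow> 'k::field) \<Rightarrow> ('a \<Rightarrow> 'a \<Rightarrow> 'k)"
  shows "\<psi> \<in> Inn1 \<Longrightarrow> is_lie_aut \<psi>"
  by (auto simp: Inn1_def intro: conj_lie_aut)

text \<open>The difference \<open>\<psi> f - f\<close> equals the bracket of
  \<open>\<beta> - inc_one\<close> with \<open>f\<close>, multiplied by \<open>\<gamma>\<close>. The
  first entry of the bracket is strictly triangular, which raises the degree by one.\<close>

lemma Inn1_Fil:
  fixes \<psi> :: "('a::{order,finite} \<Rightarrow> 'a \<Rightarrow> 'k::field) \<Rightarrow> ('a \<Rightarrow> 'a \<Rightarrow> 'k)"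
  assumes "\<psi> \<in> Inn1" "f \<in> Fil i"
  shows "\<psi> f - f \<in> Fil (Suc i)"
proof -
  obtain \<beta> \<gamma> where b: "\<beta> \<in> Inc" "\<gamma> \<in> Inc" "\<And>x. \<beta> x x = 1"
    "\<beta> \<star> \<gamma> = inc_one" "\<gamma> \<star> \<beta> = inc_one" "\<psi> = (\<lambda>f\<in>Inc. \<beta> \<star> f \<star> \<gamma>)"
    using assms(1) by (auto simp: Inn1_def)
  have f: "f \<in> Inc" using assms(2) by (rule Fil_Inc)
  have n: "\<beta> - inc_one \<in> Fil (Suc 0)"
    using b(1,3) by (simp add: Fil_1_iff Inc_diff Inc_one, simp add: inc_one_def)
  have "(\<beta> \<star> f - f \<star> \<beta>) \<star> \<gamma> = \<beta> \<star> f \<star> \<gamma> - f"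
    using b f by (simp add: inc_mult_linear inc_mult_assoc inc_mult_one)
  moreover have "\<beta> \<star> f - f \<star> \<beta> = lie_bracket (\<beta> - inc_one) f"
    using f b by (simp add: lie_bracket_def inc_mult_linear inc_mult_one)
  ultimately have "\<psi> f - f = lie_bracket (\<beta> - inc_one) f \<star> \<gamma>"
    using b f by simp
  also have "\<dots> \<in> Fil (Suc 0 + i + 0)"
    by (intro Fil_mult Fil_bracket n assms(2)) (simp add: Fil_0 b)
  finally show ?thesis by simp
qed

lemma Inn1_inverse:
  fixes \<psi> :: "('a::{order,finite} \<Rightarrow> 'a \<Rightarrow> 'k::field) \<Rightarrow> ('a \<Rightarrow> 'a \<Rightarrow> 'k)"
  assumes "\<psi> \<in> Inn1"
  shows "restrict (inv_into Inc \<psi>) Inc \<in> Inn1"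
proof -
  obtain \<beta> \<gamma> where b: "\<beta> \<in> Inc" "\<gamma> \<in> Inc" "\<And>x. \<beta> x x = 1"
    "\<beta> \<star> \<gamma> = inc_one" "\<gamma> \<star> \<beta> = inc_one" "\<psi> = (\<lambda>f\<in>Inc. \<beta> \<star> f \<star> \<gamma>)"
    using assms(1) by (auto simp: Inn1_def)
  \<comment> \<open>Diagonal entries are multiplicative, so the inverse is again unipotent.\<close>
  have "\<gamma> x x = 1" for x
    using inc_mult_diag[of \<beta> \<gamma> x] b(3,4) by (simp add: inc_one_def)
  moreover have "restrict (inv_into Inc \<psi>) Inc = (\<lambda>f\<in>Inc. \<gamma> \<star> f \<star> \<beta>)"
  proof (rule restrict_ext)
    fix f :: "'a \<Rightarrow> 'a \<Rightarrow> 'k" assume f: "f \<in> Inc"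
    note inv = lie_aut_inverse[OF Inn1_lie_aut[OF assms]]
    have "\<psi> (inv_into Inc \<psi> f) = f" using inv(2)[OF f] f by simp
    moreover have "\<psi> (\<gamma> \<star> f \<star> \<beta>) = f"
      using b f by (simp add: Inc_mult conj_inverse)
    moreover have "inv_into Inc \<psi> f \<in> Inc"
      using lie_aut_Inc[OF inv(1) f] f by simp
    ultimately show "inv_into Inc \<psi> f = \<gamma> \<star> f \<star> \<beta>"
      using lie_aut_inj[OF Inn1_lie_aut[OF assms]] Inc_mult by metis
  qed
  ultimately show ?thesis using b unfolding Inn1_def by blast
qed

lemma Inn1_compose:
  fixes \<phi> \<psi> :: "('a::{order,finite} \<Rightarrow> 'a \<Rightarrow> 'k::field) \<Rightarrow> ('a \<Rightarrow> 'a \<Rightarrow> 'k)"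
  assumes "\<phi> \<in> Inn1" "\<psi> \<in> Inn1"
  shows "compose Inc \<phi> \<psi> \<in> Inn1"
proof -
  obtain \<beta> \<gamma> where b: "\<beta> \<in> Inc" "\<gamma> \<in> Inc" "\<And>x. \<beta> x x = 1"
    "\<beta> \<star> \<gamma> = inc_one" "\<gamma> \<star> \<beta> = inc_one" "\<phi> = (\<lambda>f\<in>Inc. \<beta> \<star> f \<star> \<gamma>)"
    using assms(1) by (auto simp: Inn1_def)
  obtain \<beta>' \<gamma>' where b': "\<beta>' \<in> Inc" "\<gamma>' \<in> Inc" "\<And>x. \<beta>' x x = 1"
    "\<beta>' \<star> \<gamma>' = inc_one" "\<gamma>' \<star> \<beta>' = inc_one" "\<psi> = (\<lambda>f\<in>Inc. \<beta>' \<star> f \<star> \<gamma>')"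
    using assms(2) by (auto simp: Inn1_def)
  have "\<beta> \<star> \<beta>' \<star> (\<gamma>' \<star> \<gamma>) = \<beta> \<star> (\<beta>' \<star> \<gamma>') \<star> \<gamma>"
    using b(1,2) b'(1,2) by (simp add: inc_mult_assoc Inc_mult)
  then have 1: "\<beta> \<star> \<beta>' \<star> (\<gamma>' \<star> \<gamma>) = inc_one" using b b' by (simp add: inc_mult_one)
  have "\<gamma>' \<star> \<gamma> \<star> (\<beta> \<star> \<beta>') = \<gamma>' \<star> (\<gamma> \<star> \<beta>) \<star> \<beta>'"
    using b(1,2) b'(1,2) by (simp add: inc_mult_assoc Inc_mult)
  then have 2: "\<gamma>' \<star> \<gamma> \<star> (\<beta> \<star> \<beta>') = inc_one" using b b' by (simp add: inc_mult_one)
  have 3: "compose Inc \<phi> \<psi> = (\<lambda>f\<in>Inc. \<beta> \<star> \<beta>' \<star> f \<star> (\<gamma>' \<star> \<gamma>))"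
    using b(1,2) b'(1,2) by (auto simp: compose_def b(6) b'(6) Inc_mult inc_mult_assoc)
  have 4: "(\<beta> \<star> \<beta>') x x = 1" for x by (simp add: inc_mult_diag b(3) b'(3))
  show ?thesis unfolding Inn1_def using 1 2 3 4 Inc_mult by blast
qed

lemma Inn1_id: "(\<lambda>f\<in>Inc. f) \<in> (Inn1 :: (('a::{order,finite} \<Rightarrow> 'a \<Rightarrow> 'k::field) \<Rightarrow> ('a \<Rightarrow> 'a \<Rightarrow> 'k)) set)"
proof -
  have "(\<lambda>f\<in>Inc. f) = (\<lambda>f\<in>Inc. inc_one \<star> f \<star> (inc_one :: 'a \<Rightarrow> 'a \<Rightarrow> 'k))"
    by (rule restrict_ext) (simp add: inc_mult_one)
  moreover have "inc_one \<star> inc_one = (inc_one :: 'a \<Rightarrow> 'a \<Rightarrow> 'k)" "inc_one x x = (1::'k)" for x :: 'a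
    by (simp_all add: inc_mult_one Inc_one) (simp add: inc_one_def)
  ultimately show ?thesis unfolding Inn1_def using Inc_one by blast
qed

section \<open>Splitting a Lie automorphism\<close>

text \<open>The diagonal elements \<open>d x\<close> are part of the conclusion because they are the
  preimages of the units \<open>unit_e x x\<close> under the conjugated automorphism. The later root
  argument computes weights with them.\<close>

lemma lie_aut_Diag_conj:
  fixes \<phi> :: "('a::{order,finite} \<Rightarrow> 'a \<Rightarrow> 'k::field) \<Rightarrow> ('a \<Rightarrow> 'a \<Rightarrow> 'k)"
  assumes \<phi>: "is_lie_aut \<phi>"
  obtains \<beta> \<gamma> d where "\<beta> \<in> Inc" "\<gamma> \<in> Inc" "\<And>x. \<beta> x x = 1"
    "\<beta> \<star> \<gamma> = inc_one" "\<gamma> \<star> \<beta> = inc_one"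
    "\<And>x. d x \<in> Diag" "\<And>x. \<gamma> \<star> \<phi> (d x) \<star> \<beta> = unit_e x x"
proof -
  define \<psi> where "\<psi> = restrict (inv_into Inc \<phi>) Inc"
  note inv = lie_aut_inverse[OF \<phi>, folded \<psi>_def]
  define A where "A = \<phi> ` Diag"
  \<comment> \<open>Dropping the strictly triangular part of \<open>\<psi> (unit_e x x)\<close>
    changes its image under \<open>\<phi>\<close> only by a strictly triangular element. Hence
    \<open>a x\<close> lies in \<open>A\<close> and has the same diagonal as
    \<open>unit_e x x\<close>.\<close>
  define d where "d x = comp_L 0 (\<psi> (unit_e x x))" for x
  define a where "a x = \<phi> (d x)" for x
  have d: "d x \<in> Diag" for x by (simp add: d_def comp_L_Diag)
  have aA: "a x \<in> A" for x by (simp add: a_def A_def d)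
  have A_Inc: "f \<in> Inc" if "f \<in> A" for f
    using that by (auto simp: A_def Diag_Inc lie_aut_Inc[OF \<phi>])
  have aI: "a x \<in> Inc" for x by (intro A_Inc aA)
  have a_diag: "a x u u = unit_e x x u u" for x u
  proof -
    let ?g = "\<psi> (unit_e x x)"
    have g: "?g \<in> Inc" by (intro lie_aut_Inc[OF inv(1)] Inc_unit) simp
    have "?g - comp_L 0 ?g \<in> Fil (Suc 0)"
      by (rule Fil_diff_comp_L) (simp add: Fil_0 g)
    then have "\<phi> (?g - comp_L 0 ?g) \<in> Fil (Suc 0)" by (rule lie_aut_Fil[OF \<phi>])
    moreover have "\<phi> (?g - comp_L 0 ?g) = unit_e x x - a x"
      by (simp add: lie_aut_diff[OF \<phi>] g Inc_comp_L inv(2) Inc_unit a_def d_def)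
    ultimately show ?thesis by (simp add: Fil_1_iff)
  qed
  \<comment> \<open>Both \<open>\<phi>\<close> and \<open>\<psi>\<close> preserve the strictly
    triangular ideal, which meets the diagonal subalgebra only in 0. An identity between elements of
    \<open>A\<close> can therefore be tested on diagonal entries.\<close>
  have A_zero: "f = 0" if f: "f \<in> A" "\<And>u. f u u = 0" for f
  proof -
    obtain e where e: "e \<in> Diag" "f = \<phi> e" using f(1) by (auto simp: A_def)
    have "\<psi> f \<in> Fil (Suc 0)"
      by (rule lie_aut_Fil[OF inv(1)]) (simp add: Fil_1_iff f A_Inc)
    then have "e \<in> Fil (Suc 0)" using e by (simp add: inv(3) Diag_Inc)
    then have "e = 0" using e(1) by (auto simp: Fil_1_iff Diag_def fun_eq_iff) metis
    then show ?thesis using e by (simp add: lie_aut_zero[OF \<phi>])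
  qed
  have A_diff: "f - g \<in> A" if "f \<in> A" "g \<in> A" for f g
  proof -
    obtain e e' where "e \<in> Diag" "e' \<in> Diag" "f = \<phi> e" "g = \<phi> e'" using \<open>f \<in> A\<close> \<open>g \<in> A\<close> by (auto simp: A_def)
    moreover from this have "e - e' \<in> Diag" by (auto simp: Diag_def)
    ultimately show ?thesis
      unfolding A_def by (metis Diag_Inc image_eqI lie_aut_diff[OF \<phi>])
  qed
  have A_comm: "f \<star> g = g \<star> f" if fg: "f \<in> A" "g \<in> A" for f g
  proof -
    obtain e e' where e: "e \<in> Diag" "e' \<in> Diag" "f = \<phi> e" "g = \<phi> e'" using fg by (auto simp: A_def)
    then have "lie_bracket f g = \<phi> (lie_bracket e e')"
      by (simp add: lie_aut_bracket[OF \<phi>] Diag_Inc)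
    also have "\<dots> = 0" using e by (simp add: Diag_bracket_Diag lie_aut_zero[OF \<phi>])
    finally show ?thesis by (simp add: lie_bracket_def)
  qed
  text \<open>As a self-centralizing subspace, \<^term>\<open>A\<close> is an associative subalgebra.\<close>
  have A_cent: "f \<in> A" if f: "f \<in> Inc" "\<And>g. g \<in> A \<Longrightarrow> g \<star> f = f \<star> g" for f
  proof -
    have "\<psi> f \<in> Diag"
    proof (rule Diag_self_centralizing)
      show \<psi>f: "\<psi> f \<in> Inc" using f(1) by (rule lie_aut_Inc[OF inv(1)])
      fix x
      have "\<phi> (unit_e x x) \<in> A" by (simp add: A_def Diag_unit)
      then have "lie_bracket (\<phi> (unit_e x x)) f = 0" by (simp add: lie_bracket_def f(2))
      then have "\<phi> (lie_bracket (unit_e x x) (\<psi> f)) = \<phi> 0"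
        by (simp add: lie_aut_bracket[OF \<phi>] \<psi>f Inc_unit inv(2) f(1) lie_aut_zero[OF \<phi>])
      then show "lie_bracket (unit_e x x) (\<psi> f) = 0"
        by (rule lie_aut_inj[OF \<phi> Inc_bracket Inc_zero])
    qed
    then show ?thesis unfolding A_def by (metis f(1) image_eqI inv(2))
  qed
  have A_mult: "f \<star> g \<in> A" if fg: "f \<in> A" "g \<in> A" for f g
  proof (rule A_cent[OF Inc_mult])
    fix h assume h: "h \<in> A"
    note I = A_Inc[OF h] A_Inc[OF fg(1)] A_Inc[OF fg(2)]
    have "h \<star> (f \<star> g) = (h \<star> f) \<star> g" by (simp add: inc_mult_assoc I)
    also have "\<dots> = f \<star> (h \<star> g)" unfolding A_comm[OF h fg(1)] by (simp add: inc_mult_assoc I)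
    also have "\<dots> = f \<star> g \<star> h" unfolding A_comm[OF h fg(2)] by (simp add: inc_mult_assoc I)
    finally show "h \<star> (f \<star> g) = f \<star> g \<star> h" .
  qed
  have a_idem: "a x \<star> a x = a x" for x
  proof -
    have "a x \<star> a x - a x = 0"
      by (rule A_zero) (simp_all add: A_diff A_mult aA inc_mult_diag a_diag, simp add: unit_e_def)
    then show ?thesis by simp
  qed
  have a_orth: "a x \<star> a y = 0" if "x \<noteq> y" for x y
    using that by (intro A_zero A_mult aA) (simp add: inc_mult_diag a_diag, simp add: unit_e_def)
  \<comment> \<open>Column \<open>x\<close> of \<open>\<beta>\<close> is column \<open>x\<close> of
    \<open>a x\<close>, and row \<open>x\<close> of \<open>\<gamma>\<close> is row \<open>x\<close>
    of \<open>a x\<close>. Orthogonality of the \<open>a x\<close> makes \<open>\<beta>\<close>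
    intertwine them with the \<open>unit_e x x\<close>.\<close>
  define \<beta> where "\<beta> = (\<Sum>x\<in>UNIV. a x \<star> unit_e x x)"
  define \<gamma> where "\<gamma> = (\<Sum>x\<in>UNIV. unit_e x x \<star> a x)"
  have bI: "\<beta> \<in> Inc" and cI: "\<gamma> \<in> Inc" by (auto simp: \<beta>_def \<gamma>_def intro!: Inc_sum Inc_mult)
  have ab: "a x \<star> \<beta> = a x \<star> unit_e x x" for x
  proof -
    have "a x \<star> \<beta> = (\<Sum>y\<in>UNIV. a x \<star> a y \<star> unit_e y y)"
      by (simp add: \<beta>_def inc_mult_sum inc_mult_assoc aI Inc_unit)
    also have "\<dots> = (\<Sum>y\<in>{x}. a x \<star> a y \<star> unit_e y y)"
      by (rule sum.mono_neutral_right) (auto simp: a_orth inc_mult_zero)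
    finally show ?thesis by (simp add: a_idem)
  qed
  have be: "\<beta> \<star> unit_e x x = a x \<star> unit_e x x" for x
  proof -
    have "\<beta> \<star> unit_e x x = (\<Sum>y\<in>UNIV. a y \<star> (unit_e y y \<star> unit_e x x))"
      by (simp add: \<beta>_def inc_mult_sum inc_mult_assoc aI Inc_unit)
    also have "\<dots> = (\<Sum>y\<in>{x}. a y \<star> (unit_e y y \<star> unit_e x x))"
      by (rule sum.mono_neutral_right) (auto simp: unit_mult_unit inc_mult_zero)
    finally show ?thesis by (simp add: unit_mult_unit)
  qed
  have "\<gamma> \<star> \<beta> = (\<Sum>x\<in>UNIV. unit_e x x \<star> (a x \<star> unit_e x x))"
    by (simp add: \<gamma>_def inc_mult_sum inc_mult_assoc aI Inc_unit bI ab)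
  also have "\<dots> = inc_one"
  proof (intro ext)
    fix u v
    \<comment> \<open>Multiplying by \<open>unit_e x x\<close> on both sides keeps only the entry of
      \<open>a x\<close> at \<open>(x, x)\<close>, which is 1.\<close>
    have "(\<Sum>x\<in>UNIV. (unit_e x x \<star> (a x \<star> unit_e x x)) u v)
        = (\<Sum>x\<in>UNIV. if u = x then if v = x then 1 else 0 else (0::'k))"
      by (rule sum.cong) (auto simp: Diag_mult_left Diag_unit Diag_mult_right Inc_mult aI,
        auto simp: unit_e_def a_diag)
    then show "(\<Sum>x\<in>UNIV. unit_e x x \<star> (a x \<star> unit_e x x)) u v = inc_one u v"
      by (auto simp: sum_fun_apply2 inc_one_def)
  qed
  finally have cb: "\<gamma> \<star> \<beta> = inc_one" .
  have b_diag: "\<beta> u u = 1" for u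
  proof -
    have "\<beta> u u = (\<Sum>x\<in>UNIV. if u = x then 1 else 0)"
      unfolding \<beta>_def sum_fun_apply2 by (rule sum.cong) (auto simp: inc_mult_diag a_diag unit_e_def)
    then show ?thesis by simp
  qed
  \<comment> \<open>The one-sided identity \<open>\<gamma> \<star> \<beta> = inc_one\<close> already
    makes \<open>\<beta> \<star> \<gamma>\<close> idempotent; its complement is an idempotent with
    zero diagonal.\<close>
  have "inc_one - \<beta> \<star> \<gamma> = 0"
  proof (rule Fil_idempotent_zero)
    have "\<gamma> u u = 1" for u
      using inc_mult_diag[of \<gamma> \<beta> u] b_diag cb by (simp add: inc_one_def)
    then show "inc_one - \<beta> \<star> \<gamma> \<in> Fil (Suc 0)"
      by (simp add: Fil_1_iff Inc_diff Inc_one Inc_mult inc_mult_diag b_diag) (simp add: inc_one_def)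
    have "\<beta> \<star> \<gamma> \<star> (\<beta> \<star> \<gamma>) = \<beta> \<star> (\<gamma> \<star> \<beta>) \<star> \<gamma>"
      using bI cI by (simp add: inc_mult_assoc Inc_mult)
    then show "(inc_one - \<beta> \<star> \<gamma>) \<star> (inc_one - \<beta> \<star> \<gamma>) = inc_one - \<beta> \<star> \<gamma>"
      using bI cI by (simp add: cb inc_mult_linear inc_mult_one Inc_mult Inc_one)
  qed
  then have bc: "\<beta> \<star> \<gamma> = inc_one" by simp
  have "\<gamma> \<star> \<phi> (d x) \<star> \<beta> = unit_e x x" for x
  proof -
    have "\<gamma> \<star> \<phi> (d x) \<star> \<beta> = \<gamma> \<star> (a x \<star> \<beta>)"
      using aI bI cI by (simp add: inc_mult_assoc a_def)
    also have "\<dots> = \<gamma> \<star> \<beta> \<star> unit_e x x"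
      using bI cI by (simp add: ab be[symmetric] inc_mult_assoc Inc_unit)
    finally show ?thesis by (simp add: cb inc_mult_one Inc_unit)
  qed
  from bI cI b_diag bc cb d this show thesis by (rule that[of \<beta> \<gamma> d])
qed

text \<open>An automorphism preserving the diagonal permutes the root spaces spanned by the
  \<^term>\<open>unit_e x y\<close> with \<^term>\<open>x < y\<close>.\<close>

lemma lie_aut_unit:
  fixes \<epsilon> :: "('a::{order,finite} \<Rightarrow> 'a \<Rightarrow> 'k::field) \<Rightarrow> ('a \<Rightarrow> 'a \<Rightarrow> 'k)"
  assumes \<epsilon>: "is_lie_aut \<epsilon>" and d: "\<And>z. d z \<in> Diag" "\<And>z. \<epsilon> (d z) = unit_e z z"
    and xy: "x < y"
  obtains u v k where "u \<le> v" "k \<noteq> 0" "\<epsilon> (unit_e x y) = inc_smult k (unit_e u v)"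
proof -
  define g where "g = \<epsilon> (unit_e x y)"
  have eI: "unit_e x y \<in> Inc" using xy by (simp add: Inc_unit)
  have gI: "g \<in> Inc" unfolding g_def using \<epsilon> eI by (rule lie_aut_Inc)
  have "unit_e x y \<in> Fil (Suc 0)" using eI xy by (auto simp: Fil_1_iff unit_e_def)
  then have gF: "g \<in> Fil (Suc 0)" unfolding g_def by (rule lie_aut_Fil[OF \<epsilon>])
  have "g \<noteq> 0"
  proof
    assume "g = 0"
    then have "\<epsilon> (unit_e x y) = \<epsilon> 0" by (simp add: g_def lie_aut_zero[OF \<epsilon>])
    then have "unit_e x y = (0 :: 'a \<Rightarrow> 'a \<Rightarrow> 'k)" by (rule lie_aut_inj[OF \<epsilon> eI Inc_zero])
    then have "unit_e x y x y = (0 :: 'a \<Rightarrow> 'a \<Rightarrow> 'k) x y" by simp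
    then show False by (simp add: unit_e_def)
  qed
  then obtain u v where uv: "g u v \<noteq> 0" by (auto simp: fun_eq_iff)
  have lt: "s < t" if "g s t \<noteq> 0" for s t
    using that gF by (auto simp: Fil_1_iff Inc_def less_le)
  \<comment> \<open>Apply \<open>\<epsilon>\<close> to the weight equation of
    \<open>unit_e x y\<close> under \<open>d z\<close> and compare entries. Every position in the
    support of \<open>g\<close> must have the weight prescribed by \<open>x\<close> and
    \<open>y\<close>.\<close>
  have root: "unit_e z z s s - unit_e z z t t = d z x x - d z y y" if st: "g s t \<noteq> 0" for z s t
  proof -
    have "lie_bracket (d z) (unit_e x y) = inc_smult (d z x x - d z y y) (unit_e x y)"
      by (intro ext, unfold Diag_bracket_apply[OF d(1) eI]) (auto simp: inc_smult_def unit_e_def)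
    then have "lie_bracket (unit_e z z) g = inc_smult (d z x x - d z y y) g"
      using lie_aut_bracket[OF \<epsilon> Diag_Inc[OF d(1)] eI, of z] lie_aut_smult[OF \<epsilon> eI] d(2)
      by (simp add: g_def)
    then have "(unit_e z z s s - unit_e z z t t) * g s t = (d z x x - d z y y) * g s t"
      using Diag_bracket_apply[OF Diag_unit gI, of z s t] unfolding inc_smult_def by metis
    then show ?thesis using st by simp
  qed
  have uniq: "s = u \<and> t = v" if st: "g s t \<noteq> 0" for s t
  proof -
    have "u < v" "s < t" using lt uv st by auto
    have eq: "(unit_e z z s s - unit_e z z t t :: 'k) = unit_e z z u u - unit_e z z v v" for z
      using root[OF st, of z] root[OF uv, of z] by simp
    \<comment> \<open>Evaluating the equal weights at \<open>z = u\<close> and \<open>z = v\<close>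
      shows that \<open>u\<close> and \<open>v\<close> both occur among \<open>s\<close>,
      \<open>t\<close>. In characteristic 2 the weights do not see signs, so the order of the pair
      comes from \<open>u < v\<close> and \<open>s < t\<close>.\<close>
    have "u = s \<or> u = t"
      using eq[of u] \<open>u < v\<close> by (auto simp: unit_e_def split: if_splits)
    moreover have "v = s \<or> v = t"
      using eq[of v] \<open>u < v\<close> by (auto simp: unit_e_def split: if_splits)
    ultimately show ?thesis using \<open>u < v\<close> \<open>s < t\<close> by auto
  qed
  have "g = inc_smult (g u v) (unit_e u v)"
  proof (intro ext)
    fix s t
    have "g s t = 0 \<or> s = u \<and> t = v" using uniq by blast
    then show "g s t = inc_smult (g u v) (unit_e u v) s t"
      by (auto simp: inc_smult_def unit_e_def)
  qed
  from less_imp_le[OF lt[OF uv]] uv this show thesis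
    unfolding g_def by (rule that)
qed

text \<open>By linearity it suffices to see that the image of each matrix unit is homogeneous of the
  same length.\<close>

lemma lie_aut_Diag_graded:
  fixes \<epsilon> :: "('a::{order,finite} \<Rightarrow> 'a \<Rightarrow> 'k::field) \<Rightarrow> ('a \<Rightarrow> 'a \<Rightarrow> 'k)"
  assumes \<epsilon>: "is_lie_aut \<epsilon>" and d: "\<And>z. d z \<in> Diag" "\<And>z. \<epsilon> (d z) = unit_e z z"
  shows "graded \<epsilon>"
proof -
  have unit: "comp_L i (\<epsilon> (unit_e x y)) = (if ell x y = i then \<epsilon> (unit_e x y) else 0)"
    if xy: "x \<le> y" for i x y
  proof (cases "x = y")
    case True
    \<comment> \<open>Each \<open>unit_e z z\<close> is the image of the diagonal
      \<open>d z\<close>, so it commutes with the image of \<open>unit_e x x\<close>.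
      Self-centralization puts that image on the diagonal.\<close>
    have I: "unit_e x x \<in> Inc" by (simp add: Inc_unit)
    have "lie_bracket (unit_e z z) (\<epsilon> (unit_e x x)) = 0" for z
      using lie_aut_bracket[OF \<epsilon> Diag_Inc[OF d(1)] I, of z]
      by (simp add: d Diag_bracket_Diag Diag_unit lie_aut_zero[OF \<epsilon>])
    then have "\<epsilon> (unit_e x x) \<in> Diag"
      by (intro Diag_self_centralizing lie_aut_Inc[OF \<epsilon> I])
    then show ?thesis using True by (simp add: comp_L_of_Diag ell_refl)
  next
    case False
    with xy obtain u v k where k: "u \<le> v" "k \<noteq> 0" "\<epsilon> (unit_e x y) = inc_smult k (unit_e u v)"
      using lie_aut_unit[OF \<epsilon> d, of x y] by (auto simp: less_le)
    have "inc_smult k (unit_e u v) \<in> Fil (ell x y)"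
      using lie_aut_unit_Fil[OF \<epsilon> xy] k by simp
    moreover have "inc_smult k (unit_e u v) u v \<noteq> 0"
      using k by (simp add: inc_smult_def unit_e_def)
    ultimately have 1: "ell x y \<le> ell u v" unfolding Fil_def by blast
    \<comment> \<open>Invariance of the filtration under \<open>\<epsilon>\<close> gave one
      inequality between the lengths; invariance under its inverse gives the other.\<close>
    define \<psi> where "\<psi> = restrict (inv_into Inc \<epsilon>) Inc"
    note inv = lie_aut_inverse[OF \<epsilon>, folded \<psi>_def]
    have "unit_e x y = \<psi> (inc_smult k (unit_e u v))"
      using inv(3)[OF Inc_unit[OF xy]] k by simp
    also have "\<dots> \<in> Fil (ell u v)"
      by (intro lie_aut_Fil[OF inv(1)] Fil_smult Fil_unit k)
    finally have "unit_e x y \<in> (Fil (ell u v) :: ('a \<Rightarrow> 'a \<Rightarrow> 'k) set)" .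
    moreover have "unit_e x y x y \<noteq> (0::'k)" by (simp add: unit_e_def)
    ultimately have "ell u v \<le> ell x y" unfolding Fil_def by blast
    with 1 have "ell u v = ell x y" by simp
    then show ?thesis using k(1)
      unfolding k(3) comp_L_linear by (simp add: comp_L_unit) (simp add: inc_smult_def fun_eq_iff)
  qed
  show ?thesis unfolding graded_def
  proof (intro allI ballI)
    fix i and f :: "'a \<Rightarrow> 'a \<Rightarrow> 'k" assume f: "f \<in> Inc"
    have "\<epsilon> (comp_L i f)
        = (\<Sum>p\<in>{(x,y). x \<le> y}. inc_smult (comp_L i f (fst p) (snd p)) (\<epsilon> (unit_e (fst p) (snd p))))"
      by (rule lie_aut_expand[OF \<epsilon> Inc_comp_L])
    also have "\<dots> = (\<Sum>p\<in>{(x,y). x \<le> y}. comp_L i (inc_smult (f (fst p) (snd p)) (\<epsilon> (unit_e (fst p) (snd p)))))"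
      by (rule sum.cong[OF refl])
        (auto simp: comp_L_linear unit, auto simp: comp_L_def inc_smult_def fun_eq_iff)
    also have "\<dots> = comp_L i (\<epsilon> f)"
      by (subst lie_aut_expand[OF \<epsilon> f]) (simp add: comp_L_sum)
    finally show "\<epsilon> (comp_L i f) = comp_L i (\<epsilon> f)" .
  qed
qed

text \<open>Undoing the conjugation by \<open>\<beta>\<close> after \<open>\<phi>\<close> leaves an
  automorphism sending \<open>d x\<close> to \<open>unit_e x x\<close>, which is graded.\<close>

lemma lie_aut_split:
  fixes \<phi> :: "('a::{order,finite} \<Rightarrow> 'a \<Rightarrow> 'k::field) \<Rightarrow> ('a \<Rightarrow> 'a \<Rightarrow> 'k)"
  assumes \<phi>: "is_lie_aut \<phi>"
  obtains \<psi> \<epsilon> where "\<psi> \<in> Inn1" "is_lie_aut \<epsilon>" "graded \<epsilon>" "\<phi> = compose Inc \<psi> \<epsilon>"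
proof -
  obtain \<beta> \<gamma> d where b: "\<beta> \<in> Inc" "\<gamma> \<in> Inc" "\<And>x. \<beta> x x = 1"
    "\<beta> \<star> \<gamma> = inc_one" "\<gamma> \<star> \<beta> = inc_one"
    and d: "\<And>x. d x \<in> Diag" "\<And>x. \<gamma> \<star> \<phi> (d x) \<star> \<beta> = unit_e x x"
    using lie_aut_Diag_conj[OF \<phi>] by metis
  define \<psi> where "\<psi> = (\<lambda>f\<in>Inc. \<beta> \<star> f \<star> \<gamma>)"
  define \<epsilon> where "\<epsilon> = compose Inc (\<lambda>f\<in>Inc. \<gamma> \<star> f \<star> \<beta>) \<phi>"
  have eps: "\<epsilon> f = \<gamma> \<star> \<phi> f \<star> \<beta>" if "f \<in> Inc" for f
    using that by (simp add: \<epsilon>_def compose_eq lie_aut_Inc[OF \<phi>])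
  have \<epsilon>: "is_lie_aut \<epsilon>"
    unfolding \<epsilon>_def by (intro lie_aut_compose conj_lie_aut b \<phi>)
  have "\<psi> \<in> Inn1" unfolding \<psi>_def Inn1_def using b by blast
  moreover have "graded \<epsilon>"
    by (rule lie_aut_Diag_graded[OF \<epsilon> d(1)]) (simp add: eps d Diag_Inc)
  moreover have "\<phi> = compose Inc \<psi> \<epsilon>"
  proof (rule extensionalityI[OF lie_aut_ext[OF \<phi>] compose_extensional])
    fix f :: "'a \<Rightarrow> 'a \<Rightarrow> 'k" assume f: "f \<in> Inc"
    then show "\<phi> f = compose Inc \<psi> \<epsilon> f"
      using b by (simp add: compose_eq eps \<psi>_def Inc_mult conj_inverse lie_aut_Inc[OF \<phi>])
  qed
  ultimately show thesis using that \<epsilon> by blast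
qed

text \<open>The left factor is the identity modulo higher terms and so does not affect leading
  components. This is assumed via the filtration, not as membership in \<open>Inn1\<close>, so that
  the lemma also applies to a map not yet known to be inner.\<close>

lemma tilde_split:
  fixes \<psi> \<epsilon> :: "('a::{order,finite} \<Rightarrow> 'a \<Rightarrow> 'k::field) \<Rightarrow> ('a \<Rightarrow> 'a \<Rightarrow> 'k)"
  assumes \<psi>: "is_lie_aut \<psi>" "\<And>i f. f \<in> Fil i \<Longrightarrow> \<psi> f - f \<in> Fil (Suc i)"
    and \<epsilon>: "is_lie_aut \<epsilon>" "graded \<epsilon>"
  shows "tilde (compose Inc \<psi> \<epsilon>) = \<epsilon>"
proof (rule extensionalityI[OF _ lie_aut_ext[OF \<epsilon>(1)]])
  show "tilde (compose Inc \<psi> \<epsilon>) \<in> extensional Inc" by (simp add: tilde_def)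
  fix f :: "'a \<Rightarrow> 'a \<Rightarrow> 'k" assume f: "f \<in> Inc"
  note \<epsilon>f = lie_aut_Inc[OF \<epsilon>(1) f]
  show "tilde (compose Inc \<psi> \<epsilon>) f = \<epsilon> f"
  proof (intro ext)
    fix u v :: 'a
    let ?g = "comp_L (ell u v) (\<epsilon> f)"
    have "\<psi> ?g - ?g \<in> Fil (Suc (ell u v))" by (intro \<psi>(2) comp_L_Fil)
    \<comment> \<open>Elements of \<open>Fil (Suc (ell u v))\<close> have no entry at a position of
      length \<open>ell u v\<close>.\<close>
    then have "\<not> (\<psi> ?g - ?g) u v \<noteq> 0" unfolding Fil_def using Suc_n_not_le_n by blast
    then have "\<psi> ?g u v = \<epsilon> f u v" by (simp add: comp_L_apply \<epsilon>f)
    moreover have z: "\<epsilon> f u v = 0" if "\<not> u \<le> v" using \<epsilon>f that by (simp add: Inc_def)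
    moreover have "compose Inc \<psi> \<epsilon> (comp_L (ell u v) f) = \<psi> ?g"
      using \<epsilon>(2) f by (simp add: compose_eq Inc_comp_L graded_def)
    ultimately show "tilde (compose Inc \<psi> \<epsilon>) f u v = \<epsilon> f u v"
      using z by (simp add: tilde_apply lie_aut_compose \<psi> \<epsilon> f)
  qed
qed

section \<open>The image of \<open>tilde\<close>, and \<open>Inn1\<close> as the automorphisms
  trivial on the associated graded space\<close>

lemma compose_id_left: "is_lie_aut \<phi> \<Longrightarrow> compose Inc (\<lambda>f\<in>Inc. f) \<phi> = \<phi>"
  by (rule extensionalityI[OF compose_extensional lie_aut_ext]) (simp_all add: compose_eq lie_aut_Inc)

lemma compose_id_right: "is_lie_aut \<phi> \<Longrightarrow> compose Inc \<phi> (\<lambda>f\<in>Inc. f) = \<phi>"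
  by (rule extensionalityI[OF compose_extensional lie_aut_ext]) (simp_all add: compose_eq lie_aut_Inc)

text \<open>The graded factor of a splitting is the value of \<open>tilde\<close>, and a graded
  automorphism is its own value. This description makes closure under composition and inverses
  visible.\<close>

lemma LAut_tilde_eq: "LAut_tilde = {\<epsilon>. is_lie_aut \<epsilon> \<and> graded \<epsilon>}"
proof (intro equalityI subsetI)
  fix \<epsilon> :: "('a \<Rightarrow> 'a \<Rightarrow> 'b) \<Rightarrow> ('a \<Rightarrow> 'a \<Rightarrow> 'b)"
  assume "\<epsilon> \<in> LAut_tilde"
  then obtain \<phi> where \<phi>: "is_lie_aut \<phi>" "\<epsilon> = tilde \<phi>" by (auto simp: LAut_tilde_def LAut_def)
  from \<phi>(1) show "\<epsilon> \<in> {\<epsilon>. is_lie_aut \<epsilon> \<and> graded \<epsilon>}"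
    by (rule lie_aut_split) (simp add: \<phi>(2) tilde_split Inn1_lie_aut Inn1_Fil)
next
  fix \<epsilon> :: "('a \<Rightarrow> 'a \<Rightarrow> 'b) \<Rightarrow> ('a \<Rightarrow> 'a \<Rightarrow> 'b)"
  assume "\<epsilon> \<in> {\<epsilon>. is_lie_aut \<epsilon> \<and> graded \<epsilon>}"
  then have \<epsilon>: "is_lie_aut \<epsilon>" "graded \<epsilon>" by auto
  have "tilde (compose Inc (\<lambda>f\<in>Inc. f) \<epsilon>) = \<epsilon>"
    by (intro tilde_split \<epsilon> Inn1_Fil Inn1_lie_aut Inn1_id)
  then have "\<epsilon> = tilde \<epsilon>" using \<epsilon> by (simp add: compose_id_left)
  then show "\<epsilon> \<in> LAut_tilde" using \<epsilon> by (auto simp: LAut_tilde_def LAut_def)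
qed

text \<open>This criterion mentions only the filtration, which every Lie automorphism preserves, so
  it is stable under conjugation. For the converse, \<open>tilde \<chi>\<close> is computed from two
  factorizations of \<open>\<chi>\<close>: its splitting, and \<open>\<chi>\<close> followed on the
  right by the identity. Hence \<open>\<epsilon>\<close> is the identity.\<close>

lemma Inn1_iff:
  fixes \<chi> :: "('a::{order,finite} \<Rightarrow> 'a \<Rightarrow> 'k::field) \<Rightarrow> ('a \<Rightarrow> 'a \<Rightarrow> 'k)"
  assumes \<chi>: "is_lie_aut \<chi>"
  shows "\<chi> \<in> Inn1 \<longleftrightarrow> (\<forall>i. \<forall>f\<in>Fil i. \<chi> f - f \<in> Fil (Suc i))"
proof
  assume "\<forall>i. \<forall>f\<in>Fil i. \<chi> f - f \<in> Fil (Suc i)"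
  then have F: "\<And>i f. f \<in> Fil i \<Longrightarrow> \<chi> f - f \<in> Fil (Suc i)" by blast
  obtain \<psi> \<epsilon> where s: "\<psi> \<in> Inn1" "is_lie_aut \<epsilon>" "graded \<epsilon>" "\<chi> = compose Inc \<psi> \<epsilon>"
    using lie_aut_split[OF \<chi>] .
  have id: "graded (\<lambda>f\<in>Inc. f :: 'a \<Rightarrow> 'a \<Rightarrow> 'k)" by (simp add: graded_def Inc_comp_L)
  have "\<epsilon> = tilde \<chi>"
    using s by (simp add: tilde_split Inn1_lie_aut Inn1_Fil)
  also have "\<dots> = tilde (compose Inc \<chi> (\<lambda>f\<in>Inc. f))" by (simp add: compose_id_right \<chi>)
  also have "\<dots> = (\<lambda>f\<in>Inc. f)" by (intro tilde_split \<chi> F lie_aut_id id)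
  finally show "\<chi> \<in> Inn1" using s by (simp add: compose_id_right Inn1_lie_aut)
qed (auto intro: Inn1_Fil)

section \<open>The group of Lie automorphisms and its semidirect decomposition\<close>

lemma LAut_subgroup: "subgroup {\<phi>. is_lie_aut \<phi>} (BijGroup Inc)"
proof
  show "{\<phi>. is_lie_aut \<phi>} \<subseteq> carrier (BijGroup Inc)"
    by (auto simp: BijGroup_def is_lie_aut_def)
  show "\<one>\<^bsub>BijGroup Inc\<^esub> \<in> {\<phi>. is_lie_aut \<phi>}"
    by (simp add: BijGroup_def lie_aut_id)
  fix \<phi> \<psi> :: "('a \<Rightarrow> 'a \<Rightarrow> 'b) \<Rightarrow> ('a \<Rightarrow> 'a \<Rightarrow> 'b)"
  assume \<phi>: "\<phi> \<in> {\<phi>. is_lie_aut \<phi>}"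
  then have B: "\<phi> \<in> Bij Inc" by (simp add: is_lie_aut_def)
  show "inv\<^bsub>BijGroup Inc\<^esub> \<phi> \<in> {\<phi>. is_lie_aut \<phi>}"
    using \<phi> lie_aut_inverse(1) by (simp add: inv_BijGroup[OF B])
  assume \<psi>: "\<psi> \<in> {\<phi>. is_lie_aut \<phi>}"
  then have "\<psi> \<in> Bij Inc" by (simp add: is_lie_aut_def)
  then show "\<phi> \<otimes>\<^bsub>BijGroup Inc\<^esub> \<psi> \<in> {\<phi>. is_lie_aut \<phi>}"
    using B \<phi> \<psi> by (simp add: BijGroup_def lie_aut_compose)
qed

lemma LAut_simps:
  shows "group LAut" "carrier LAut = {\<phi>. is_lie_aut \<phi>}" "\<one>\<^bsub>LAut\<^esub> = (\<lambda>f\<in>Inc. f)"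
    and "is_lie_aut \<phi> \<Longrightarrow> is_lie_aut \<psi> \<Longrightarrow> \<phi> \<otimes>\<^bsub>LAut\<^esub> \<psi> = compose Inc \<phi> \<psi>"
    and "is_lie_aut \<phi> \<Longrightarrow> inv\<^bsub>LAut\<^esub> \<phi> = restrict (inv_into Inc \<phi>) Inc"
proof -
  show "group LAut" unfolding LAut_def
    by (rule subgroup.subgroup_is_group[OF LAut_subgroup group_BijGroup])
  show "carrier LAut = {\<phi>. is_lie_aut \<phi>}" "\<one>\<^bsub>LAut\<^esub> = (\<lambda>f\<in>Inc. f)"
    by (simp_all add: LAut_def BijGroup_def)
  show "\<phi> \<otimes>\<^bsub>LAut\<^esub> \<psi> = compose Inc \<phi> \<psi>" if "is_lie_aut \<phi>" "is_lie_aut \<psi>"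
    using that by (simp add: LAut_def BijGroup_def is_lie_aut_def)
  show "inv\<^bsub>LAut\<^esub> \<phi> = restrict (inv_into Inc \<phi>) Inc" if "is_lie_aut \<phi>"
    using that group.m_inv_consistent[OF group_BijGroup LAut_subgroup, of \<phi>]
    by (simp add: LAut_def inv_BijGroup is_lie_aut_def)
qed

theorem theorem4p15:
  assumes "poset_connected TYPE('a::{order,finite})"
  shows "internal_semidirect (LAut :: (('a \<Rightarrow> 'a \<Rightarrow> 'k::field) \<Rightarrow> ('a \<Rightarrow> 'a \<Rightarrow> 'k)) monoid)
           Inn1 LAut_tilde"
proof -
  let ?G = "LAut :: (('a \<Rightarrow> 'a \<Rightarrow> 'k) \<Rightarrow> ('a \<Rightarrow> 'a \<Rightarrow> 'k)) monoid"
  note H = LAut_tilde_eq[where ?'a = 'a and ?'b = 'k]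
  have gid: "graded (\<lambda>f\<in>Inc. f :: 'a \<Rightarrow> 'a \<Rightarrow> 'k)" by (simp add: graded_def Inc_comp_L)
  have subN: "subgroup Inn1 ?G"
    by standard (auto simp: LAut_simps Inn1_lie_aut Inn1_compose Inn1_id Inn1_inverse)
  have subH: "subgroup LAut_tilde ?G"
    unfolding H
    by standard (auto simp: LAut_simps gid lie_aut_id lie_aut_compose graded_compose
        lie_aut_inverse(1) graded_inverse)
  have "\<phi> \<otimes>\<^bsub>?G\<^esub> \<psi> \<otimes>\<^bsub>?G\<^esub> inv\<^bsub>?G\<^esub> \<phi> \<in> Inn1" if \<phi>: "\<phi> \<in> carrier ?G" and \<psi>: "\<psi> \<in> Inn1" for \<phi> \<psi>
  proof -
    have \<phi>': "is_lie_aut \<phi>" using \<phi> by (simp add: LAut_simps)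
    note \<psi>' = Inn1_lie_aut[OF \<psi>]
    define \<rho> where "\<rho> = restrict (inv_into Inc \<phi>) Inc"
    note inv = lie_aut_inverse[OF \<phi>', folded \<rho>_def]
    let ?\<chi> = "compose Inc (compose Inc \<phi> \<psi>) \<rho>"
    \<comment> \<open>The difference is the image under \<open>\<phi>\<close> of
      \<open>\<psi> (\<rho> f) - \<rho> f\<close>; here \<open>\<rho>\<close> keeps the degree,
      \<open>\<psi>\<close> raises it, and \<open>\<phi>\<close> keeps it again.\<close>
    have "?\<chi> f - f \<in> Fil (Suc i)" if f: "f \<in> Fil i" for f i
    proof -
      note fI = Fil_Inc[OF f]
      have r: "\<rho> f \<in> Fil i" by (rule lie_aut_Fil[OF inv(1) f])
      have "\<phi> (\<psi> (\<rho> f) - \<rho> f) \<in> Fil (Suc i)"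
        by (intro lie_aut_Fil[OF \<phi>'] Inn1_Fil[OF \<psi>] r)
      moreover have "\<phi> (\<psi> (\<rho> f) - \<rho> f) = ?\<chi> f - f"
        using fI Fil_Inc[OF r]
        by (simp add: lie_aut_diff[OF \<phi>'] lie_aut_Inc[OF \<psi>'] compose_eq inv(2))
      ultimately show ?thesis by simp
    qed
    then have "?\<chi> \<in> Inn1"
      by (subst Inn1_iff) (auto intro!: lie_aut_compose \<phi>' \<psi>' inv(1))
    then show ?thesis
      using inv(1) by (simp add: LAut_simps \<phi>' \<psi>' lie_aut_compose \<rho>_def)
  qed
  then have N: "Inn1 \<lhd> ?G"
    using subN by (simp add: group.normal_inv_iff[OF LAut_simps(1)])
  have "\<psi> = (\<lambda>f\<in>Inc. f)" if "\<psi> \<in> Inn1" "\<psi> \<in> LAut_tilde" for \<psi> :: "('a \<Rightarrow> 'a \<Rightarrow> 'k) \<Rightarrow> ('a \<Rightarrow> 'a \<Rightarrow> 'k)"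
  proof -
    have \<psi>: "is_lie_aut \<psi>" "graded \<psi>" using that by (auto simp: H)
    \<comment> \<open>Compute \<open>tilde \<psi>\<close> twice: with \<open>\<psi>\<close> as the
      graded factor the result is \<open>\<psi>\<close>, with \<open>\<psi>\<close> as the unipotent
      factor it is the identity.\<close>
    have "\<psi> = tilde (compose Inc (\<lambda>f\<in>Inc. f) \<psi>)"
      by (intro tilde_split[symmetric] \<psi> Inn1_Fil Inn1_lie_aut Inn1_id)
    also have "\<dots> = tilde (compose Inc \<psi> (\<lambda>f\<in>Inc. f))"
      by (simp add: compose_id_left compose_id_right \<psi>)
    also have "\<dots> = (\<lambda>f\<in>Inc. f)"
      using that(1) by (intro tilde_split \<psi> Inn1_Fil lie_aut_id gid)
    finally show ?thesis .
  qed
  moreover have "\<one>\<^bsub>?G\<^esub> \<in> Inn1" "\<one>\<^bsub>?G\<^esub> \<in> LAut_tilde"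
    by (rule subgroup.one_closed[OF subN], rule subgroup.one_closed[OF subH])
  ultimately have int: "Inn1 \<inter> LAut_tilde = {\<one>\<^bsub>?G\<^esub>}"
    unfolding LAut_simps(3) by blast
  have "\<phi> \<in> Inn1 <#>\<^bsub>?G\<^esub> LAut_tilde" if "is_lie_aut \<phi>" for \<phi>
    using that
  proof (rule lie_aut_split)
    fix \<psi> \<epsilon> :: "('a \<Rightarrow> 'a \<Rightarrow> 'k) \<Rightarrow> ('a \<Rightarrow> 'a \<Rightarrow> 'k)"
    assume s: "\<psi> \<in> Inn1" "is_lie_aut \<epsilon>" "graded \<epsilon>" "\<phi> = compose Inc \<psi> \<epsilon>"
    then have "\<phi> = \<psi> \<otimes>\<^bsub>?G\<^esub> \<epsilon>" by (simp add: LAut_simps Inn1_lie_aut)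
    moreover have "\<epsilon> \<in> LAut_tilde" using s by (simp add: H)
    ultimately show ?thesis using s(1) unfolding set_mult_def by blast
  qed
  moreover have "Inn1 <#>\<^bsub>?G\<^esub> LAut_tilde \<subseteq> carrier ?G"
    by (intro group.setmult_subset_G[OF LAut_simps(1)] subgroup.subset subN subH)
  ultimately have "Inn1 <#>\<^bsub>?G\<^esub> LAut_tilde = carrier ?G"
    by (auto simp: LAut_simps)
  with N subH int show ?thesis
    by (simp add: internal_semidirect_def LAut_simps(1))
qed

end
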